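(* Let $\mathcal P=[X:\mathcal R]$ be an inverse monoid presentation of an inverse monoid $M$, with Squier complex $\mathrm{Sq}(\mathcal P)$ on the vertex set $\mathcal T=\mathcal T(M,X)$. Then the fundamental groupoid $\pi(\mathrm{Sq}(\mathcal P),\mathcal T)$, with the left and right actions of $\mathcal T$ induced by $t\rhd(p,l,r,q)=(tp,l,r,q)$ and $(p,l,r,q)\lhd t=(p,l,r,qt)$ on edges, is pseudoregular and monoidal.
   Context: Maps are written on the right and composed left to right. **Presentation and factorisation.** $A=X\sqcup X^{-1}$, $A^*$ is the free monoid on $A$, $\mathcal R\subseteq A^*\times A^*$; $\rho:A^*\to \mathrm{FIM}(X)$ is the canonical map to the free inverse monoid; $M$ is the quotient of $\mathrm{FIM}(X)$ by the congruence generated by the pairs $(l\rho,r\rho)$, $(l,r)\in\mathcal R$, with quotient map $\theta$. Let $\theta_{\min}$ be the congruence on $\mathrm{FIM}(X)$: $a\,\theta_{\min}\,b$ iff there is an idempotent $e$ with $ae=be$ and $(a^{-1}a)\theta=e\theta=(b^{-1}b)\theta$. Put $\mathcal T=\mathrm{FIM}(X)/\theta_{\min}$, with quotient map $\tau:\mathrm{FIM}(X)\to\mathcal T$. **Squier complex.** $\mathrm{Sq}(\mathcal P)$ is the $2$-complex with vertex set $\mathcal T$; an edge $(p,l,r,q)$ for all $p,q\in\mathcal T$, $(l,r)\in\mathcal R$, from $p(l\rho\tau)q$ to $p(r\rho\tau)q$; and, for all $p,q,p',q'\in\mathcal T$ and $(l,r),(l',r')\in\mathcal R$, a $2$-cell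 making the paths $(p,l,r,qp'(l'\rho\tau)q')\circ(p(r\rho\tau)qp',l',r',q')$ and $(p(l\rho\tau)qp',l',r',q')\circ(p,l,r,qp'(r'\rho\tau)q')$ homotopic. $\pi(\mathrm{Sq}(\mathcal P),\mathcal T)$ is its fundamental groupoid on the vertex set $\mathcal T$ (fixed-end-point homotopy classes of edge paths). **Semiregular, pseudoregular, monoidal.** A groupoid $G$ with vertex set $V(G)$, domain and range maps $\mathbf d,\mathbf r$, and composition $\circ$ is semiregular if $V(G)$ is a monoid with identity $e$ and there are left and right actions $x\rhd\alpha$, $\alpha\lhd x$ of $V(G)$ on $G$ such that for all $x,y\in V(G)$ and $\alpha,\beta\in G$: (a) $(xy)\rhd\alpha=x\rhd(y\rhd\alpha)$, $\alpha\lhd(xy)=(\alpha\lhd x)\lhd y$, $(x\rhd\alpha)\lhd y=x\rhd(\alpha\lhd y)$; (b) $e\rhd\alpha=\alpha=\alpha\lhd e$; (c) $(x\rhd\alpha)\mathbf d=x(\alpha\mathbf d)$, $(\alpha\lhd x)\mathbf d=(\alpha\mathbf d)x$, $(x\rhd\alpha)\mathbf r=x(\alpha\mathbf r)$, $(\alpha\lhd x)\mathbf r=(\alpha\mathbf r)x$; (d) $x\rhd(\alpha\circ\beta)=(x\rhd\alpha)\circ(x\rhd\beta)$ and $(\alpha\circ\beta)\lhd x=(\alpha\lhd x)\circ(\beta\lhd x)$ whenever $\alpha\circ\beta$ is defined; (e) $x\rhd 1_y=1_{xy}=1_x\lhd y$. It is pseudoregular if moreover $V(G)$ is an inverse monoid.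 A semiregular groupoid is monoidal if the operations $\alpha\ast\beta=(\alpha\lhd\beta\mathbf d)\circ(\alpha\mathbf r\rhd\beta)$ and $\alpha\circledast\beta=(\alpha\mathbf d\rhd\beta)\circ(\alpha\lhd\beta\mathbf r)$ coincide. *)

theory Defs
  imports "HOL-Algebra.Group" "HOL.Hull"
begin

section \<open>Monoid congruences, quotients and inverse monoids\<close>

definition monoid_congruence :: "('a, 'm) monoid_scheme \<Rightarrow> ('a \<times> 'a) set \<Rightarrow> bool" where
  "monoid_congruence G r \<longleftrightarrow>
     equiv (carrier G) r \<and>
     (\<forall>a b c. (a, b) \<in> r \<and> c \<in> carrier G \<longrightarrow>
        (c \<otimes>\<^bsub>G\<^esub> a, c \<otimes>\<^bsub>G\<^esub> b) \<in> r \<and> (a \<otimes>\<^bsub>G\<^esub> c, b \<otimes>\<^bsub>G\<^esub> c) \<in> r)"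

definition quotient_monoid :: "('a, 'm) monoid_scheme \<Rightarrow> ('a \<times> 'a) set \<Rightarrow> 'a set monoid" where
  "quotient_monoid G r =
     \<lparr>carrier = carrier G // r,
      mult = (\<lambda>A B. \<Union>a\<in>A. \<Union>b\<in>B. r `` {a \<otimes>\<^bsub>G\<^esub> b}),
      one = r `` {\<one>\<^bsub>G\<^esub>}\<rparr>"

locale inverse_monoid = monoid G for G (structure) +
  assumes ex1_inverse:
    "x \<in> carrier G \<Longrightarrow> \<exists>!y. y \<in> carrier G \<and> x \<otimes> y \<otimes> x = x \<and> y \<otimes> x \<otimes> y = y"

text \<open>The inverse in the sense of inverse monoids. It is not the operation
  \<^const>\<open>m_inv\<close>, which is the inverse of a unit.\<close>

definition sinv :: "('a, 'm) monoid_scheme \<Rightarrow> 'a \<Rightarrow> 'a" where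
  "sinv G x = (THE y. y \<in> carrier G \<and> x \<otimes>\<^bsub>G\<^esub> y \<otimes>\<^bsub>G\<^esub> x = x \<and> y \<otimes>\<^bsub>G\<^esub> x \<otimes>\<^bsub>G\<^esub> y = y)"

definition idempotents :: "('a, 'm) monoid_scheme \<Rightarrow> 'a set" where
  "idempotents G = {e \<in> carrier G. e \<otimes>\<^bsub>G\<^esub> e = e}"


section \<open>The free inverse monoid\<close>

text \<open>The letter \<open>Inl x\<close> stands for the generator \<open>x\<close> and \<open>Inr x\<close> for its formal inverse.\<close>

type_synonym 'x word = "('x + 'x) list"

definition words :: "'x set \<Rightarrow> 'x word set" where
  "words X = lists (X <+> X)"

definition free_monoid :: "'x set \<Rightarrow> 'x word monoid" where
  "free_monoid X = \<lparr>carrier = words X, mult = (@), one = []\<rparr>"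

definition word_inv :: "'x word \<Rightarrow> 'x word" where
  "word_inv w = map (case_sum Inr Inl) (rev w)"

definition vagner_pairs :: "'x set \<Rightarrow> ('x word \<times> 'x word) set" where
  "vagner_pairs X =
     {(u @ word_inv u @ u, u) | u. u \<in> words X} \<union>
     {(u @ word_inv u @ v @ word_inv v, v @ word_inv v @ u @ word_inv u) | u v.
        u \<in> words X \<and> v \<in> words X}"

definition vagner_congruence :: "'x set \<Rightarrow> ('x word \<times> 'x word) set" where
  "vagner_congruence X = monoid_congruence (free_monoid X) hull vagner_pairs X"

definition FIM :: "'x set \<Rightarrow> 'x word set monoid" where
  "FIM X = quotient_monoid (free_monoid X) (vagner_congruence X)"

definition rho :: "'x set \<Rightarrow> 'x word \<Rightarrow> 'x word set" where
  "rho X w = vagner_congruence X `` {w}"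


section \<open>The presented inverse monoid and the monoid of vertices\<close>

definition presentation_congruence ::
    "'x set \<Rightarrow> ('x word \<times> 'x word) set \<Rightarrow> ('x word set \<times> 'x word set) set" where
  "presentation_congruence X R =
     monoid_congruence (FIM X) hull {(rho X l, rho X r) | l r. (l, r) \<in> R}"

definition presented_monoid ::
    "'x set \<Rightarrow> ('x word \<times> 'x word) set \<Rightarrow> 'x word set set monoid" where
  "presented_monoid X R = quotient_monoid (FIM X) (presentation_congruence X R)"

text \<open>The quotient map from \<^term>\<open>FIM X\<close> to \<^term>\<open>presented_monoid X R\<close>.\<close>

definition theta ::
    "'x set \<Rightarrow> ('x word \<times> 'x word) set \<Rightarrow> 'x word set \<Rightarrow> 'x word set set" where
  "theta X R a = presentation_congruence X R `` {a}"

definition theta_min ::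
    "'x set \<Rightarrow> ('x word \<times> 'x word) set \<Rightarrow> ('x word set \<times> 'x word set) set" where
  "theta_min X R =
     {(a, b). a \<in> carrier (FIM X) \<and> b \<in> carrier (FIM X) \<and>
        (\<exists>e \<in> idempotents (FIM X).
           a \<otimes>\<^bsub>FIM X\<^esub> e = b \<otimes>\<^bsub>FIM X\<^esub> e \<and>
           theta X R (sinv (FIM X) a \<otimes>\<^bsub>FIM X\<^esub> a) = theta X R e \<and>
           theta X R e = theta X R (sinv (FIM X) b \<otimes>\<^bsub>FIM X\<^esub> b))}"

type_synonym 'x vert = "'x word set set"

definition vertex_monoid :: "'x set \<Rightarrow> ('x word \<times> 'x word) set \<Rightarrow> 'x vert monoid" where
  "vertex_monoid X R = quotient_monoid (FIM X) (theta_min X R)"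

definition tau :: "'x set \<Rightarrow> ('x word \<times> 'x word) set \<Rightarrow> 'x word set \<Rightarrow> 'x vert" where
  "tau X R a = theta_min X R `` {a}"


section \<open>2-complexes and edge paths\<close>

text \<open>A signed edge is \<open>(e, True)\<close> for the edge \<open>e\<close> and \<open>(e, False)\<close> for its reverse.
  A path \<open>(u, es, v)\<close> records its end points, so that there is an empty path at each vertex.
  A 2-cell \<open>(u, P, Q, v)\<close> is attached along the parallel paths \<open>(u, P, v)\<close> and \<open>(u, Q, v)\<close>.\<close>

type_synonym 'e signed = "'e \<times> bool"
type_synonym ('v, 'e) path = "'v \<times> 'e signed list \<times> 'v"

record ('v, 'e) two_complex =
  verts :: "'v set"
  edges :: "'e set"
  src :: "'e \<Rightarrow> 'v"
  tgt :: "'e \<Rightarrow> 'v"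
  cells :: "('v \<times> 'e signed list \<times> 'e signed list \<times> 'v) set"

fun start_of :: "('v, 'e) two_complex \<Rightarrow> 'e signed \<Rightarrow> 'v" where
  "start_of K (e, b) = (if b then src K e else tgt K e)"

fun end_of :: "('v, 'e) two_complex \<Rightarrow> 'e signed \<Rightarrow> 'v" where
  "end_of K (e, b) = (if b then tgt K e else src K e)"

fun reverse_edge :: "'e signed \<Rightarrow> 'e signed" where
  "reverse_edge (e, b) = (e, \<not> b)"

fun is_path :: "('v, 'e) two_complex \<Rightarrow> 'v \<Rightarrow> 'e signed list \<Rightarrow> 'v \<Rightarrow> bool" where
  "is_path K u [] v \<longleftrightarrow> u \<in> verts K \<and> u = v"
| "is_path K u (a # as) v \<longleftrightarrow>
     u \<in> verts K \<and> fst a \<in> edges K \<and> start_of K a = u \<and> is_path K (end_of K a) as v"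

definition paths :: "('v, 'e) two_complex \<Rightarrow> ('v, 'e) path set" where
  "paths K = {(u, es, v). is_path K u es v}"

fun path_concat :: "('v, 'e) path \<Rightarrow> ('v, 'e) path \<Rightarrow> ('v, 'e) path" where
  "path_concat (u, es, v) (v', fs, w) = (u, es @ fs, w)"

inductive_set homotopy :: "('v, 'e) two_complex \<Rightarrow> (('v, 'e) path \<times> ('v, 'e) path) set"
  for K :: "('v, 'e) two_complex" where
  homotopy_refl: "p \<in> paths K \<Longrightarrow> (p, p) \<in> homotopy K"
| homotopy_sym: "(p, q) \<in> homotopy K \<Longrightarrow> (q, p) \<in> homotopy K"
| homotopy_trans: "(p, q) \<in> homotopy K \<Longrightarrow> (q, r) \<in> homotopy K \<Longrightarrow> (p, r) \<in> homotopy K"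
| homotopy_cancel: "(u, as @ [a, reverse_edge a] @ bs, v) \<in> paths K \<Longrightarrow>
    ((u, as @ [a, reverse_edge a] @ bs, v), (u, as @ bs, v)) \<in> homotopy K"
| homotopy_cell: "(x, P, Q, y) \<in> cells K \<Longrightarrow> is_path K u as x \<Longrightarrow> is_path K y bs v \<Longrightarrow>
    ((u, as @ P @ bs, v), (u, as @ Q @ bs, v)) \<in> homotopy K"


section \<open>Groupoids\<close>

record ('v, 'a) groupoid_data =
  Vert :: "'v set"
  Arr :: "'a set"
  dm :: "'a \<Rightarrow> 'v"
  rg :: "'a \<Rightarrow> 'v"
  cmp :: "'a \<Rightarrow> 'a \<Rightarrow> 'a"
  idn :: "'v \<Rightarrow> 'a"

text \<open>Composition is in diagrammatic order: \<open>cmp G \<alpha> \<beta>\<close> is meaningful when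
  \<open>rg G \<alpha> = dm G \<beta>\<close>.\<close>

locale groupoid =
  fixes G :: "('v, 'a) groupoid_data"
  assumes dm_in: "\<alpha> \<in> Arr G \<Longrightarrow> dm G \<alpha> \<in> Vert G"
    and rg_in: "\<alpha> \<in> Arr G \<Longrightarrow> rg G \<alpha> \<in> Vert G"
    and cmp_in: "\<lbrakk>\<alpha> \<in> Arr G; \<beta> \<in> Arr G; rg G \<alpha> = dm G \<beta>\<rbrakk> \<Longrightarrow> cmp G \<alpha> \<beta> \<in> Arr G"
    and dm_cmp: "\<lbrakk>\<alpha> \<in> Arr G; \<beta> \<in> Arr G; rg G \<alpha> = dm G \<beta>\<rbrakk> \<Longrightarrow> dm G (cmp G \<alpha> \<beta>) = dm G \<alpha>"
    and rg_cmp: "\<lbrakk>\<alpha> \<in> Arr G; \<beta> \<in> Arr G; rg G \<alpha> = dm G \<beta>\<rbrakk> \<Longrightarrow> rg G (cmp G \<alpha> \<beta>) = rg G \<beta>"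
    and cmp_assoc: "\<lbrakk>\<alpha> \<in> Arr G; \<beta> \<in> Arr G; \<gamma> \<in> Arr G; rg G \<alpha> = dm G \<beta>; rg G \<beta> = dm G \<gamma>\<rbrakk>
      \<Longrightarrow> cmp G (cmp G \<alpha> \<beta>) \<gamma> = cmp G \<alpha> (cmp G \<beta> \<gamma>)"
    and idn_in: "x \<in> Vert G \<Longrightarrow> idn G x \<in> Arr G"
    and dm_idn: "x \<in> Vert G \<Longrightarrow> dm G (idn G x) = x"
    and rg_idn: "x \<in> Vert G \<Longrightarrow> rg G (idn G x) = x"
    and cmp_idn_left: "\<alpha> \<in> Arr G \<Longrightarrow> cmp G (idn G (dm G \<alpha>)) \<alpha> = \<alpha>"
    and cmp_idn_right: "\<alpha> \<in> Arr G \<Longrightarrow> cmp G \<alpha> (idn G (rg G \<alpha>)) = \<alpha>"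
    and ex_inverse: "\<alpha> \<in> Arr G \<Longrightarrow>
      \<exists>\<beta> \<in> Arr G. dm G \<beta> = rg G \<alpha> \<and> rg G \<beta> = dm G \<alpha> \<and>
        cmp G \<alpha> \<beta> = idn G (dm G \<alpha>) \<and> cmp G \<beta> \<alpha> = idn G (rg G \<alpha>)"

text \<open>The monoid \<open>V\<close> is the monoid structure on the vertex set; \<open>la x \<alpha>\<close> is
  \<open>x \<rhd> \<alpha>\<close> and \<open>ra \<alpha> x\<close> is \<open>\<alpha> \<lhd> x\<close>.\<close>

locale semiregular_groupoid = groupoid G + monoid V
  for G :: "('v, 'a) groupoid_data" and V :: "'v monoid" (structure) +
  fixes la :: "'v \<Rightarrow> 'a \<Rightarrow> 'a" and ra :: "'a \<Rightarrow> 'v \<Rightarrow> 'a"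
  assumes carrier_eq: "carrier V = Vert G"
    and la_in: "\<lbrakk>x \<in> Vert G; \<alpha> \<in> Arr G\<rbrakk> \<Longrightarrow> la x \<alpha> \<in> Arr G"
    and ra_in: "\<lbrakk>x \<in> Vert G; \<alpha> \<in> Arr G\<rbrakk> \<Longrightarrow> ra \<alpha> x \<in> Arr G"
    and la_mult: "\<lbrakk>x \<in> Vert G; y \<in> Vert G; \<alpha> \<in> Arr G\<rbrakk> \<Longrightarrow> la (x \<otimes> y) \<alpha> = la x (la y \<alpha>)"
    and ra_mult: "\<lbrakk>x \<in> Vert G; y \<in> Vert G; \<alpha> \<in> Arr G\<rbrakk> \<Longrightarrow> ra \<alpha> (x \<otimes> y) = ra (ra \<alpha> x) y"
    and la_ra: "\<lbrakk>x \<in> Vert G; y \<in> Vert G; \<alpha> \<in> Arr G\<rbrakk> \<Longrightarrow> ra (la x \<alpha>) y = la x (ra \<alpha> y)"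
    and la_one: "\<alpha> \<in> Arr G \<Longrightarrow> la \<one> \<alpha> = \<alpha>"
    and ra_one: "\<alpha> \<in> Arr G \<Longrightarrow> ra \<alpha> \<one> = \<alpha>"
    and dm_la: "\<lbrakk>x \<in> Vert G; \<alpha> \<in> Arr G\<rbrakk> \<Longrightarrow> dm G (la x \<alpha>) = x \<otimes> dm G \<alpha>"
    and dm_ra: "\<lbrakk>x \<in> Vert G; \<alpha> \<in> Arr G\<rbrakk> \<Longrightarrow> dm G (ra \<alpha> x) = dm G \<alpha> \<otimes> x"
    and rg_la: "\<lbrakk>x \<in> Vert G; \<alpha> \<in> Arr G\<rbrakk> \<Longrightarrow> rg G (la x \<alpha>) = x \<otimes> rg G \<alpha>"
    and rg_ra: "\<lbrakk>x \<in> Vert G; \<alpha> \<in> Arr G\<rbrakk> \<Longrightarrow> rg G (ra \<alpha> x) = rg G \<alpha> \<otimes> x"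
    and la_cmp: "\<lbrakk>x \<in> Vert G; \<alpha> \<in> Arr G; \<beta> \<in> Arr G; rg G \<alpha> = dm G \<beta>\<rbrakk>
      \<Longrightarrow> la x (cmp G \<alpha> \<beta>) = cmp G (la x \<alpha>) (la x \<beta>)"
    and ra_cmp: "\<lbrakk>x \<in> Vert G; \<alpha> \<in> Arr G; \<beta> \<in> Arr G; rg G \<alpha> = dm G \<beta>\<rbrakk>
      \<Longrightarrow> ra (cmp G \<alpha> \<beta>) x = cmp G (ra \<alpha> x) (ra \<beta> x)"
    and la_idn: "\<lbrakk>x \<in> Vert G; y \<in> Vert G\<rbrakk> \<Longrightarrow> la x (idn G y) = idn G (x \<otimes> y)"
    and ra_idn: "\<lbrakk>x \<in> Vert G; y \<in> Vert G\<rbrakk> \<Longrightarrow> ra (idn G x) y = idn G (x \<otimes> y)"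

locale pseudoregular_groupoid = semiregular_groupoid G V la ra + inverse_monoid V
  for G :: "('v, 'a) groupoid_data" and V :: "'v monoid" (structure)
    and la :: "'v \<Rightarrow> 'a \<Rightarrow> 'a" and ra :: "'a \<Rightarrow> 'v \<Rightarrow> 'a"

locale monoidal_groupoid = semiregular_groupoid G V la ra
  for G :: "('v, 'a) groupoid_data" and V :: "'v monoid" (structure)
    and la :: "'v \<Rightarrow> 'a \<Rightarrow> 'a" and ra :: "'a \<Rightarrow> 'v \<Rightarrow> 'a" +
  assumes interchange: "\<lbrakk>\<alpha> \<in> Arr G; \<beta> \<in> Arr G\<rbrakk> \<Longrightarrow>
    cmp G (ra \<alpha> (dm G \<beta>)) (la (rg G \<alpha>) \<beta>) = cmp G (la (dm G \<alpha>) \<beta>) (ra \<alpha> (rg G \<beta>))"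


section \<open>The fundamental groupoid\<close>

definition path_class :: "('v, 'e) two_complex \<Rightarrow> ('v, 'e) path \<Rightarrow> ('v, 'e) path set" where
  "path_class K p = homotopy K `` {p}"

text \<open>Homotopic paths have the same end points, so \<^const>\<open>the_elem\<close> is applied to singletons.\<close>

definition fundamental_groupoid ::
    "('v, 'e) two_complex \<Rightarrow> ('v, ('v, 'e) path set) groupoid_data" where
  "fundamental_groupoid K =
     \<lparr>Vert = verts K,
      Arr = paths K // homotopy K,
      dm = (\<lambda>\<alpha>. the_elem ((\<lambda>(u, es, v). u) ` \<alpha>)),
      rg = (\<lambda>\<alpha>. the_elem ((\<lambda>(u, es, v). v) ` \<alpha>)),
      cmp = (\<lambda>\<alpha> \<beta>. \<Union>p\<in>\<alpha>. \<Union>q\<in>\<beta>. path_class K (path_concat p q)),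
      idn = (\<lambda>u. path_class K (u, [], u))\<rparr>"

definition edge_class :: "('v, 'e) two_complex \<Rightarrow> 'e \<Rightarrow> ('v, 'e) path set" where
  "edge_class K e = path_class K (src K e, [(e, True)], tgt K e)"

text \<open>The map on homotopy classes induced by \<open>f\<close> on vertices and \<open>g\<close> on edges.\<close>

fun map_path :: "('v \<Rightarrow> 'v) \<Rightarrow> ('e \<Rightarrow> 'e) \<Rightarrow> ('v, 'e) path \<Rightarrow> ('v, 'e) path" where
  "map_path f g (u, es, v) = (f u, map (map_prod g id) es, f v)"

definition induced ::
    "('v, 'e) two_complex \<Rightarrow> ('v \<Rightarrow> 'v) \<Rightarrow> ('e \<Rightarrow> 'e) \<Rightarrow> ('v, 'e) path set \<Rightarrow> ('v, 'e) path set" where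
  "induced K f g \<alpha> = (\<Union>p\<in>\<alpha>. path_class K (map_path f g p))"


section \<open>The Squier complex\<close>

type_synonym 'x sq_edge = "'x vert \<times> 'x word \<times> 'x word \<times> 'x vert"

definition squier ::
    "'x set \<Rightarrow> ('x word \<times> 'x word) set \<Rightarrow> ('x vert, 'x sq_edge) two_complex" where
  "squier X R =
     (let T = vertex_monoid X R;
          m = (\<lambda>a b. a \<otimes>\<^bsub>T\<^esub> b);
          t = (\<lambda>w. tau X R (rho X w))
      in
      \<lparr>verts = carrier T,
       edges = {(p, l, r, q) | p l r q. p \<in> carrier T \<and> (l, r) \<in> R \<and> q \<in> carrier T},
       src = (\<lambda>(p, l, r, q). m (m p (t l)) q),
       tgt = (\<lambda>(p, l, r, q). m (m p (t r)) q),
       cells =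
         {(m (m (m (m (m p (t l)) q) p') (t l')) q',
           [((p, l, r, m (m (m q p') (t l')) q'), True),
            ((m (m (m p (t r)) q) p', l', r', q'), True)],
           [((m (m (m p (t l)) q) p', l', r', q'), True),
            ((p, l, r, m (m (m q p') (t r')) q'), True)],
           m (m (m (m (m p (t r)) q) p') (t r')) q')
          | p l r q p' l' r' q'.
            p \<in> carrier T \<and> q \<in> carrier T \<and> p' \<in> carrier T \<and> q' \<in> carrier T \<and>
            (l, r) \<in> R \<and> (l', r') \<in> R}\<rparr>)"

definition left_edge ::
    "'x set \<Rightarrow> ('x word \<times> 'x word) set \<Rightarrow> 'x vert \<Rightarrow> 'x sq_edge \<Rightarrow> 'x sq_edge" where
  "left_edge X R t = (\<lambda>(p, l, r, q). (t \<otimes>\<^bsub>vertex_monoid X R\<^esub> p, l, r, q))"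

definition right_edge ::
    "'x set \<Rightarrow> ('x word \<times> 'x word) set \<Rightarrow> 'x sq_edge \<Rightarrow> 'x vert \<Rightarrow> 'x sq_edge" where
  "right_edge X R = (\<lambda>(p, l, r, q) t. (p, l, r, q \<otimes>\<^bsub>vertex_monoid X R\<^esub> t))"

definition left_action ::
    "'x set \<Rightarrow> ('x word \<times> 'x word) set \<Rightarrow>
     'x vert \<Rightarrow> ('x vert, 'x sq_edge) path set \<Rightarrow> ('x vert, 'x sq_edge) path set" where
  "left_action X R t =
     induced (squier X R) (\<lambda>x. t \<otimes>\<^bsub>vertex_monoid X R\<^esub> x) (left_edge X R t)"

definition right_action ::
    "'x set \<Rightarrow> ('x word \<times> 'x word) set \<Rightarrow>
     ('x vert, 'x sq_edge) path set \<Rightarrow> 'x vert \<Rightarrow> ('x vert, 'x sq_edge) path set" where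
  "right_action X R \<alpha> t =
     induced (squier X R) (\<lambda>x. x \<otimes>\<^bsub>vertex_monoid X R\<^esub> t) (\<lambda>e. right_edge X R e t) \<alpha>"

end

theory Submission
  imports Defs
begin

text \<open>Quotients of inverse monoids are inverse (Lallement), so the vertex monoid is an inverse monoid
  once \<^const>\<open>theta_min\<close> is seen to be a congruence.
  Multiplication by a vertex on either side is an endomorphism of the Squier complex, and the actions
  are the functors these endomorphisms induce, so the action laws reduce to equations between
  endomorphisms. The set of pairs of arrows that interchange is closed under composition and
  inversion in each argument, and for two edges interchange is exactly a 2-cell.\<close>

section \<open>Inverse monoids\<close>

text \<open>Two obstacles hide behind the word "congruence". The free inverse monoid is given by
  Vagner's pairs, which make only elements of the form u u^-1 commute, while commutation is wanted
  for all idempotents; so each idempotent must first be brought to that form. For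
  \<open>theta_min\<close>, right multiplication by c carries the witnessing idempotent e to c^-1 e
  c, but under left multiplication e may be too large, because the domain idempotent (c a)^-1 (c a)
  can lie strictly below a^-1 a. The witness is cut down by this idempotent, and it serves c b as
  well because \<open>theta_min\<close> is contained in the presentation congruence.

  For interchange, arrows are generated by edges and their inverses, but 2-cells are given for
  positive edges only. Inverses are reached by turning a commuting square around: a b = c d gives
  a^-1 c = b d^-1. The 2-cells carry separate middle parameters q and p', so every pair of edges,
  composable or not, has a cell of the required shape.\<close>

context monoid
begin

text \<open>Commuting idempotents force uniqueness: if \<open>y\<close> and \<open>z\<close> are
  inverses of \<open>x\<close>, each equals \<open>y \<otimes> x \<otimes> z\<close>. The criterion
  serves both for the free inverse monoid and for quotients, where idempotents are easier to control
  than uniqueness.\<close>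

lemma inverse_monoidI:
  assumes inv: "\<And>x. x \<in> carrier G \<Longrightarrow> \<exists>y \<in> carrier G. x \<otimes> y \<otimes> x = x \<and> y \<otimes> x \<otimes> y = y"
    and comm: "\<And>e f. e \<in> idempotents G \<Longrightarrow> f \<in> idempotents G \<Longrightarrow> e \<otimes> f = f \<otimes> e"
  shows "inverse_monoid G"
proof
  fix x assume x: "x \<in> carrier G"
  then obtain y where y: "y \<in> carrier G" "x \<otimes> y \<otimes> x = x" "y \<otimes> x \<otimes> y = y"
    using inv by blast
  show "\<exists>!y. y \<in> carrier G \<and> x \<otimes> y \<otimes> x = x \<and> y \<otimes> x \<otimes> y = y"
  proof (rule ex1I[of _ y])
    fix z assume "z \<in> carrier G \<and> x \<otimes> z \<otimes> x = x \<and> z \<otimes> x \<otimes> z = z"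
    then have z: "z \<in> carrier G" "x \<otimes> z \<otimes> x = x" "z \<otimes> x \<otimes> z = z" by auto
    have idem: "y \<otimes> x \<in> idempotents G" "z \<otimes> x \<in> idempotents G"
      "x \<otimes> y \<in> idempotents G" "x \<otimes> z \<in> idempotents G"
      using x y z by (simp_all add: idempotents_def flip: m_assoc)
    have "y = y \<otimes> x \<otimes> z \<otimes> (x \<otimes> y)"
      using x y z by (metis m_assoc m_closed)
    also have "\<dots> = y \<otimes> (x \<otimes> z \<otimes> (x \<otimes> y))"
      using x y(1) z(1) by (simp add: m_assoc)
    also have "\<dots> = y \<otimes> (x \<otimes> y \<otimes> (x \<otimes> z))"
      using comm[OF idem(3,4)] by simp
    also have "\<dots> = y \<otimes> x \<otimes> z"
      using x y z by (metis m_assoc m_closed)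
    finally have 1: "y = y \<otimes> x \<otimes> z" .
    have "z = z \<otimes> x \<otimes> (y \<otimes> x) \<otimes> z"
      using x y z by (metis m_assoc m_closed)
    also have "\<dots> = y \<otimes> x \<otimes> (z \<otimes> x) \<otimes> z"
      using comm[OF idem(1,2)] by simp
    also have "\<dots> = y \<otimes> x \<otimes> z"
      using x y z by (metis m_assoc m_closed)
    finally show "z = y" using 1 by simp
  qed (use y in auto)
qed

end

section \<open>Commutation of idempotents and the inverse of a product\<close>

context inverse_monoid
begin

lemma sinv_props:
  assumes "x \<in> carrier G"
  shows "sinv G x \<in> carrier G \<and> x \<otimes> sinv G x \<otimes> x = x \<and> sinv G x \<otimes> x \<otimes> sinv G x = sinv G x"
  unfolding sinv_def by (rule theI'[OF ex1_inverse[OF assms]])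

lemma sinv_closed [simp]: "x \<in> carrier G \<Longrightarrow> sinv G x \<in> carrier G"
  and mult_sinv_mult: "x \<in> carrier G \<Longrightarrow> x \<otimes> sinv G x \<otimes> x = x"
  and sinv_mult_sinv: "x \<in> carrier G \<Longrightarrow> sinv G x \<otimes> x \<otimes> sinv G x = sinv G x"
  using sinv_props by auto

lemma inverse_unique:
  assumes "x \<in> carrier G" "y \<in> carrier G" "z \<in> carrier G"
    and "x \<otimes> y \<otimes> x = x" "y \<otimes> x \<otimes> y = y" "x \<otimes> z \<otimes> x = x" "z \<otimes> x \<otimes> z = z"
  shows "y = z"
  using ex1_inverse[of x] assms by blast

lemma sinv_unique:
  assumes "x \<in> carrier G" "y \<in> carrier G" "x \<otimes> y \<otimes> x = x" "y \<otimes> x \<otimes> y = y"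
  shows "sinv G x = y"
  using inverse_unique[of x "sinv G x" y] assms sinv_props by blast

text \<open>If \<open>x\<close> is the inverse of \<open>e \<otimes> f\<close>, then
  \<open>y = f \<otimes> x \<otimes> e\<close> is idempotent, hence its own inverse. Since
  \<open>e \<otimes> f\<close> is an inverse of \<open>y\<close> too, uniqueness gives
  \<open>e \<otimes> f = y\<close>.\<close>

lemma idempotents_mult:
  assumes "e \<in> idempotents G" "f \<in> idempotents G"
  shows "e \<otimes> f \<in> idempotents G"
proof -
  have e: "e \<in> carrier G" "e \<otimes> e = e" and f: "f \<in> carrier G" "f \<otimes> f = f"
    using assms by (auto simp: idempotents_def)
  define x where "x = sinv G (e \<otimes> f)"
  have x: "x \<in> carrier G" "e \<otimes> f \<otimes> x \<otimes> (e \<otimes> f) = e \<otimes> f" "x \<otimes> (e \<otimes> f) \<otimes> x = x"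
    unfolding x_def using e f sinv_props[of "e \<otimes> f"] by auto
  define y where "y = f \<otimes> x \<otimes> e"
  have y: "y \<in> carrier G" using e f x by (simp add: y_def)
  have yy: "y \<otimes> y = y"
  proof -
    have "y \<otimes> y = f \<otimes> (x \<otimes> (e \<otimes> f) \<otimes> x) \<otimes> e"
      unfolding y_def using e(1) f(1) x(1) by (simp add: m_assoc)
    then show ?thesis unfolding x(3) y_def .
  qed
  have "e \<otimes> f \<otimes> y \<otimes> (e \<otimes> f) = e \<otimes> (f \<otimes> f) \<otimes> x \<otimes> ((e \<otimes> e) \<otimes> f)"
    unfolding y_def using e(1) f(1) x(1) by (simp add: m_assoc)
  then have 1: "e \<otimes> f \<otimes> y \<otimes> (e \<otimes> f) = e \<otimes> f" using e f x by simp
  have "y \<otimes> (e \<otimes> f) \<otimes> y = f \<otimes> (x \<otimes> ((e \<otimes> e) \<otimes> (f \<otimes> f)) \<otimes> x) \<otimes> e"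
    unfolding y_def using e(1) f(1) x(1) by (simp add: m_assoc)
  then have 2: "y \<otimes> (e \<otimes> f) \<otimes> y = y" using e f x by (simp add: y_def)
  have "e \<otimes> f = y"
    by (rule inverse_unique[of y]) (use 1 2 e f y yy in auto)
  then show ?thesis using y yy by (simp add: idempotents_def)
qed

text \<open>By \<open>idempotents_mult\<close> both products are idempotent, so
  \<open>e \<otimes> f\<close> has itself and \<open>f \<otimes> e\<close> as inverses.\<close>

lemma idempotents_commute:
  assumes "e \<in> idempotents G" "f \<in> idempotents G"
  shows "e \<otimes> f = f \<otimes> e"
proof -
  have e: "e \<in> carrier G" "e \<otimes> e = e" and f: "f \<in> carrier G" "f \<otimes> f = f"
    using assms by (auto simp: idempotents_def)
  have ef: "e \<otimes> f \<otimes> (e \<otimes> f) = e \<otimes> f" and fe: "f \<otimes> e \<otimes> (f \<otimes> e) = f \<otimes> e"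
    using idempotents_mult assms by (auto simp: idempotents_def)
  have "e \<otimes> f \<otimes> (f \<otimes> e) \<otimes> (e \<otimes> f) = e \<otimes> (f \<otimes> f) \<otimes> ((e \<otimes> e) \<otimes> f)"
    using e(1) f(1) by (simp add: m_assoc)
  also have "\<dots> = e \<otimes> f" using e f ef by simp
  finally have 1: "e \<otimes> f \<otimes> (f \<otimes> e) \<otimes> (e \<otimes> f) = e \<otimes> f" .
  have "f \<otimes> e \<otimes> (e \<otimes> f) \<otimes> (f \<otimes> e) = f \<otimes> (e \<otimes> e) \<otimes> ((f \<otimes> f) \<otimes> e)"
    using e(1) f(1) by (simp add: m_assoc)
  also have "\<dots> = f \<otimes> e" using e f fe by simp
  finally have 2: "f \<otimes> e \<otimes> (e \<otimes> f) \<otimes> (f \<otimes> e) = f \<otimes> e" .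
  show ?thesis
    by (rule inverse_unique[of "e \<otimes> f"]) (use e f ef 1 2 in auto)
qed

lemma sinv_mult_idempotent: "x \<in> carrier G \<Longrightarrow> sinv G x \<otimes> x \<in> idempotents G"
  and mult_sinv_idempotent: "x \<in> carrier G \<Longrightarrow> x \<otimes> sinv G x \<in> idempotents G"
  by (simp_all add: idempotents_def mult_sinv_mult sinv_mult_sinv flip: m_assoc)

text \<open>Everything rests on exchanging the idempotents \<open>sinv G x \<otimes> x\<close> and
  \<open>y \<otimes> sinv G y\<close>, which meet in the middle of the products.\<close>

lemma sinv_mult:
  assumes x: "x \<in> carrier G" and y: "y \<in> carrier G"
  shows "sinv G (x \<otimes> y) = sinv G y \<otimes> sinv G x"
proof (rule sinv_unique)
  note cl = x y sinv_closed[OF x] sinv_closed[OF y]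
  note comm = idempotents_commute[OF sinv_mult_idempotent[OF x] mult_sinv_idempotent[OF y]]
  have "x \<otimes> y \<otimes> (sinv G y \<otimes> sinv G x) \<otimes> (x \<otimes> y)
      = x \<otimes> (y \<otimes> sinv G y \<otimes> (sinv G x \<otimes> x)) \<otimes> y"
    using cl by (simp add: m_assoc)
  also have "\<dots> = x \<otimes> (sinv G x \<otimes> x \<otimes> (y \<otimes> sinv G y)) \<otimes> y"
    by (simp add: comm)
  also have "\<dots> = (x \<otimes> sinv G x \<otimes> x) \<otimes> (y \<otimes> sinv G y \<otimes> y)"
    using cl by (simp add: m_assoc)
  finally show "x \<otimes> y \<otimes> (sinv G y \<otimes> sinv G x) \<otimes> (x \<otimes> y) = x \<otimes> y"
    using x y by (simp add: mult_sinv_mult)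
  have "sinv G y \<otimes> sinv G x \<otimes> (x \<otimes> y) \<otimes> (sinv G y \<otimes> sinv G x)
      = sinv G y \<otimes> (sinv G x \<otimes> x \<otimes> (y \<otimes> sinv G y)) \<otimes> sinv G x"
    using cl by (simp add: m_assoc)
  also have "\<dots> = sinv G y \<otimes> (y \<otimes> sinv G y \<otimes> (sinv G x \<otimes> x)) \<otimes> sinv G x"
    by (simp add: comm)
  also have "\<dots> = (sinv G y \<otimes> y \<otimes> sinv G y) \<otimes> (sinv G x \<otimes> x \<otimes> sinv G x)"
    using cl by (simp add: m_assoc)
  finally show "sinv G y \<otimes> sinv G x \<otimes> (x \<otimes> y) \<otimes> (sinv G y \<otimes> sinv G x) = sinv G y \<otimes> sinv G x"
    using x y by (simp add: sinv_mult_sinv)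
qed (use x y in auto)

end

section \<open>Congruences\<close>

text \<open>Makes hulls into congruences. Nonemptiness matters: the empty intersection is the full
  relation on the type, which may leave the carrier.\<close>

lemma monoid_congruence_Inter:
  assumes "S \<noteq> {}" "\<And>r. r \<in> S \<Longrightarrow> monoid_congruence G r"
  shows "monoid_congruence G (\<Inter>S)"
proof -
  have "equiv (carrier G) (\<Inter>S)"
  proof (rule equivI)
    show "\<Inter>S \<subseteq> carrier G \<times> carrier G"
      using assms unfolding monoid_congruence_def equiv_def by blast
    show "refl_on (carrier G) (\<Inter>S)" "sym (\<Inter>S)" "trans (\<Inter>S)"
      using assms unfolding monoid_congruence_def equiv_def refl_on_def sym_def trans_def
      by blast+
  qed
  then show ?thesis
    using assms(2) unfolding monoid_congruence_def by blast
qed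

text \<open>Supplies a member of the family intersected in the hull of a relation on the
  carrier.\<close>

lemma (in monoid) monoid_congruence_full: "monoid_congruence G (carrier G \<times> carrier G)"
  unfolding monoid_congruence_def by (auto intro!: equivI refl_onI symI transI)

lemma (in monoid) monoid_congruence_hull:
  assumes "P \<subseteq> carrier G \<times> carrier G"
  shows "monoid_congruence G (monoid_congruence G hull P)"
  unfolding hull_def
  by (rule monoid_congruence_Inter) (use assms monoid_congruence_full in auto)

locale monoid_with_congruence = monoid G for G (structure) +
  fixes r assumes congruence: "monoid_congruence G r"
begin

lemma equiv: "equiv (carrier G) r"
  using congruence by (simp add: monoid_congruence_def)

lemma rel_carrier: "(a, b) \<in> r \<Longrightarrow> a \<in> carrier G \<and> b \<in> carrier G"
  using equiv unfolding equiv_def by blast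

lemma rel_refl: "a \<in> carrier G \<Longrightarrow> (a, a) \<in> r"
  using equiv unfolding equiv_def by (blast dest: refl_onD)

lemma rel_sym: "(a, b) \<in> r \<Longrightarrow> (b, a) \<in> r"
  using equiv unfolding equiv_def by (blast dest: symD)

lemma rel_trans: "(a, b) \<in> r \<Longrightarrow> (b, c) \<in> r \<Longrightarrow> (a, c) \<in> r"
  using equiv unfolding equiv_def by (blast dest: transD)

lemma rel_mult: "(a, b) \<in> r \<Longrightarrow> (c, d) \<in> r \<Longrightarrow> (a \<otimes> c, b \<otimes> d) \<in> r"
  using congruence rel_carrier unfolding monoid_congruence_def by (meson rel_trans)

lemma class_eq_iff: "a \<in> carrier G \<Longrightarrow> b \<in> carrier G \<Longrightarrow> r `` {a} = r `` {b} \<longleftrightarrow> (a, b) \<in> r"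
  using eq_equiv_class_iff[OF equiv] by blast

lemma class_in: "a \<in> carrier G \<Longrightarrow> r `` {a} \<in> carrier (quotient_monoid G r)"
  by (simp add: quotient_monoid_def quotientI)

lemma classE:
  assumes "A \<in> carrier (quotient_monoid G r)"
  obtains a where "a \<in> carrier G" "A = r `` {a}"
  using assms by (auto simp: quotient_monoid_def elim: quotientE)

text \<open>The product of classes is defined as a union over all representatives; compatibility
  makes the united sets equal.\<close>

lemma class_mult:
  assumes "a \<in> carrier G" "b \<in> carrier G"
  shows "r `` {a} \<otimes>\<^bsub>quotient_monoid G r\<^esub> r `` {b} = r `` {a \<otimes> b}"
proof -
  have inner: "(\<Union>y\<in>r `` {b}. r `` {x \<otimes> y}) = r `` {a \<otimes> b}" if "x \<in> r `` {a}" for x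
  proof (rule SUP_eq_const)
    show "r `` {b} \<noteq> {}" using rel_refl[OF assms(2)] by blast
    show "r `` {x \<otimes> y} = r `` {a \<otimes> b}" if "y \<in> r `` {b}" for y
      using equiv_class_eq[OF equiv rel_mult[of a x b y]] that \<open>x \<in> r `` {a}\<close>
      by (simp only: Image_singleton_iff)
  qed
  have "(\<Union>x\<in>r `` {a}. \<Union>y\<in>r `` {b}. r `` {x \<otimes> y}) = r `` {a \<otimes> b}"
    by (rule SUP_eq_const[OF _ inner]) (use rel_refl[OF assms(1)] in blast)
  then show ?thesis by (simp add: quotient_monoid_def)
qed

lemma class_one: "\<one>\<^bsub>quotient_monoid G r\<^esub> = r `` {\<one>}"
  by (simp add: quotient_monoid_def)

lemma quotient_is_monoid: "monoid (quotient_monoid G r)"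
proof
  fix A B assume "A \<in> carrier (quotient_monoid G r)" "B \<in> carrier (quotient_monoid G r)"
  then show "A \<otimes>\<^bsub>quotient_monoid G r\<^esub> B \<in> carrier (quotient_monoid G r)"
    by (auto elim!: classE simp: class_mult intro!: class_in)
qed (auto elim!: classE simp: class_mult class_one m_assoc intro!: class_in)

end

section \<open>Quotients of inverse monoids\<close>

locale inverse_monoid_with_congruence = inverse_monoid G + monoid_with_congruence G r
  for G (structure) and r
begin

text \<open>Lallement's lemma: if \<open>x\<close> is an inverse of \<open>a \<otimes> a\<close>, then \<open>a \<otimes> x \<otimes> a\<close> is an idempotent
  related to \<open>a\<close>.\<close>

lemma idempotent_class:
  assumes "A \<in> idempotents (quotient_monoid G r)"
  obtains e where "e \<in> idempotents G" "A = r `` {e}"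
proof -
  obtain a where a: "a \<in> carrier G" "A = r `` {a}"
    using assms by (auto simp: idempotents_def elim: classE)
  have aa: "(a, a \<otimes> a) \<in> r"
    using assms a by (simp add: idempotents_def class_mult class_eq_iff rel_sym)
  define x where "x = sinv G (a \<otimes> a)"
  have x: "x \<in> carrier G" "a \<otimes> a \<otimes> x \<otimes> (a \<otimes> a) = a \<otimes> a" "x \<otimes> (a \<otimes> a) \<otimes> x = x"
    unfolding x_def using a sinv_props[of "a \<otimes> a"] by auto
  have "a \<otimes> x \<otimes> a \<otimes> (a \<otimes> x \<otimes> a) = a \<otimes> (x \<otimes> (a \<otimes> a) \<otimes> x) \<otimes> a"
    using a(1) x(1) by (simp add: m_assoc)
  then have "a \<otimes> x \<otimes> a \<in> idempotents G"
    using a x by (simp add: idempotents_def)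
  \<comment> \<open>Both outer factors \<open>a\<close> are replaced by the related
    \<open>a \<otimes> a\<close>; the result collapses because \<open>x\<close> is an inverse of
    \<open>a \<otimes> a\<close>.\<close>
  moreover have "(a \<otimes> x \<otimes> a, a \<otimes> a) \<in> r"
    using rel_mult[OF rel_mult[OF aa rel_refl[OF x(1)]] aa] x by simp
  then have "A = r `` {a \<otimes> x \<otimes> a}"
    using a x aa by (simp add: class_eq_iff) (meson rel_sym rel_trans)
  ultimately show thesis using that by blast
qed

text \<open>The class of \<open>sinv G a\<close> is an inverse of the class of \<open>a\<close>, and
  commutation is inherited from idempotent representatives.\<close>

lemma quotient_is_inverse_monoid: "inverse_monoid (quotient_monoid G r)"
proof -
  interpret Q: monoid "quotient_monoid G r" by (rule quotient_is_monoid)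
  show ?thesis
  proof (rule Q.inverse_monoidI)
    fix A assume "A \<in> carrier (quotient_monoid G r)"
    then obtain a where a: "a \<in> carrier G" "A = r `` {a}" by (rule classE)
    show "\<exists>B\<in>carrier (quotient_monoid G r).
        A \<otimes>\<^bsub>quotient_monoid G r\<^esub> B \<otimes>\<^bsub>quotient_monoid G r\<^esub> A = A \<and>
        B \<otimes>\<^bsub>quotient_monoid G r\<^esub> A \<otimes>\<^bsub>quotient_monoid G r\<^esub> B = B"
      by (rule bexI[of _ "r `` {sinv G a}"])
        (use a in \<open>simp_all add: class_mult class_in mult_sinv_mult sinv_mult_sinv\<close>)
  next
    fix A B assume "A \<in> idempotents (quotient_monoid G r)" "B \<in> idempotents (quotient_monoid G r)"
    then obtain e f where "e \<in> idempotents G" "A = r `` {e}" "f \<in> idempotents G" "B = r `` {f}"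
      by (metis idempotent_class)
    then show "A \<otimes>\<^bsub>quotient_monoid G r\<^esub> B = B \<otimes>\<^bsub>quotient_monoid G r\<^esub> A"
      using idempotents_commute[of e f] by (simp add: idempotents_def class_mult)
  qed
qed

text \<open>Inverses in the quotient are unique, so the class of \<open>sinv G a\<close> depends
  only on the class of \<open>a\<close>.\<close>

lemma rel_sinv:
  assumes "(a, b) \<in> r"
  shows "(sinv G a, sinv G b) \<in> r"
proof -
  interpret Q: inverse_monoid "quotient_monoid G r" by (rule quotient_is_inverse_monoid)
  have ab: "a \<in> carrier G" "b \<in> carrier G" "r `` {a} = r `` {b}"
    using assms rel_carrier class_eq_iff by blast+
  have "sinv (quotient_monoid G r) (r `` {x}) = r `` {sinv G x}" if "x \<in> carrier G" for x
    by (rule Q.sinv_unique)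
      (use that in \<open>simp_all add: class_mult class_in mult_sinv_mult sinv_mult_sinv\<close>)
  then show ?thesis using ab by (metis class_eq_iff sinv_closed)
qed

end

section \<open>The free inverse monoid and the vertex monoid\<close>

lemma free_monoid_is_monoid: "monoid (free_monoid X)"
  by unfold_locales (auto simp: free_monoid_def words_def)

lemma word_inv_in: "w \<in> words X \<Longrightarrow> word_inv w \<in> words X"
  by (fastforce simp: words_def word_inv_def split: sum.split)

lemma word_inv_word_inv [simp]: "word_inv (word_inv w) = w"
  by (auto simp: word_inv_def rev_map intro!: map_idI split: sum.split)

lemma free_monoid_vagner: "monoid_with_congruence (free_monoid X) (vagner_congruence X)"
proof -
  interpret monoid "free_monoid X" by (rule free_monoid_is_monoid)
  have "vagner_pairs X \<subseteq> carrier (free_monoid X) \<times> carrier (free_monoid X)"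
    using word_inv_in[of _ X] by (fastforce simp: vagner_pairs_def free_monoid_def words_def)
  then show ?thesis
    by unfold_locales (simp add: vagner_congruence_def monoid_congruence_hull)
qed

lemma FIM_is_inverse_monoid: "inverse_monoid (FIM X)"
proof -
  interpret F: monoid_with_congruence "free_monoid X" "vagner_congruence X"
    by (rule free_monoid_vagner)
  interpret I: monoid "FIM X" unfolding FIM_def by (rule F.quotient_is_monoid)
  have in_iff: "u \<in> carrier (free_monoid X) \<longleftrightarrow> u \<in> words X" for u
    by (simp add: free_monoid_def)
  have rho_in: "rho X u \<in> carrier (FIM X)" if "u \<in> words X" for u
    using that F.class_in by (simp add: rho_def FIM_def in_iff)
  have rho_mult: "rho X u \<otimes>\<^bsub>FIM X\<^esub> rho X v = rho X (u @ v)" if "u \<in> words X" "v \<in> words X" for u v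
    using that F.class_mult[of u v] by (simp add: rho_def FIM_def in_iff) (simp add: free_monoid_def)
  have app_in: "u @ v \<in> words X" if "u \<in> words X" "v \<in> words X" for u v
    using that by (simp add: words_def)
  have pairs: "rho X u = rho X v" if "(u, v) \<in> vagner_pairs X" for u v
  proof -
    have "(u, v) \<in> vagner_congruence X"
      using that hull_subset[of "vagner_pairs X"] by (auto simp: vagner_congruence_def)
    then show ?thesis unfolding rho_def using F.equiv equiv_class_eq by fast
  qed
  let ?i = "\<lambda>u. rho X (word_inv u)"
  have reg: "rho X u \<otimes>\<^bsub>FIM X\<^esub> ?i u \<otimes>\<^bsub>FIM X\<^esub> rho X u = rho X u" if "u \<in> words X" for u
  proof -
    have "rho X (u @ word_inv u @ u) = rho X u"
      by (rule pairs) (use that in \<open>auto simp: vagner_pairs_def\<close>)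
    then show ?thesis using that by (simp add: rho_mult app_in word_inv_in)
  qed
  have reg': "?i u \<otimes>\<^bsub>FIM X\<^esub> rho X u \<otimes>\<^bsub>FIM X\<^esub> ?i u = ?i u" if "u \<in> words X" for u
    using reg[of "word_inv u"] that by (simp add: word_inv_in)
  have comm: "(rho X u \<otimes>\<^bsub>FIM X\<^esub> ?i u) \<otimes>\<^bsub>FIM X\<^esub> (rho X v \<otimes>\<^bsub>FIM X\<^esub> ?i v)
      = (rho X v \<otimes>\<^bsub>FIM X\<^esub> ?i v) \<otimes>\<^bsub>FIM X\<^esub> (rho X u \<otimes>\<^bsub>FIM X\<^esub> ?i u)"
    if "u \<in> words X" "v \<in> words X" for u v
  proof -
    have "rho X (u @ word_inv u @ v @ word_inv v) = rho X (v @ word_inv v @ u @ word_inv u)"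
      by (rule pairs) (use that in \<open>auto simp: vagner_pairs_def\<close>)
    then show ?thesis using that by (simp add: rho_mult app_in word_inv_in)
  qed
  have rhoE: "\<exists>u. u \<in> words X \<and> A = rho X u" if "A \<in> carrier (FIM X)" for A
    using that F.classE[of A] by (auto simp: FIM_def rho_def in_iff)
  \<comment> \<open>An idempotent turns out to equal its formal inverse \<open>?i u\<close>, which
    puts it in the form covered by \<open>comm\<close>.\<close>
  have idem: "\<exists>u. u \<in> words X \<and> E = rho X u \<otimes>\<^bsub>FIM X\<^esub> ?i u" if "E \<in> idempotents (FIM X)" for E
  proof -
    have E: "E \<in> carrier (FIM X)" "E \<otimes>\<^bsub>FIM X\<^esub> E = E"
      using that by (auto simp: idempotents_def)
    obtain u where u: "u \<in> words X" "E = rho X u" using rhoE[OF E(1)] by blast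
    define E' where "E' = ?i u"
    have E': "E' \<in> carrier (FIM X)" using u by (simp add: E'_def rho_in word_inv_in)
    have 1: "E \<otimes>\<^bsub>FIM X\<^esub> E' \<otimes>\<^bsub>FIM X\<^esub> E = E" "E' \<otimes>\<^bsub>FIM X\<^esub> E \<otimes>\<^bsub>FIM X\<^esub> E' = E'"
      using reg reg' u by (simp_all add: E'_def)
    have 2: "E' \<otimes>\<^bsub>FIM X\<^esub> E \<otimes>\<^bsub>FIM X\<^esub> (E \<otimes>\<^bsub>FIM X\<^esub> E') = E \<otimes>\<^bsub>FIM X\<^esub> E' \<otimes>\<^bsub>FIM X\<^esub> (E' \<otimes>\<^bsub>FIM X\<^esub> E)"
      using comm[of "word_inv u" u] u by (simp add: E'_def word_inv_in)
    \<comment> \<open>Doubling the idempotent \<open>E\<close> in E' = E' E E' gives (E' E)(E E'),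
      and commutation puts \<open>E\<close> at both ends. Hence \<open>E'\<close> absorbs
      \<open>E\<close> on either side, and E = E E' E collapses to E'.\<close>
    have 3: "E' = E \<otimes>\<^bsub>FIM X\<^esub> E' \<otimes>\<^bsub>FIM X\<^esub> (E' \<otimes>\<^bsub>FIM X\<^esub> E)"
      using 1 2 E E' by (metis I.m_assoc I.m_closed)
    have "E \<otimes>\<^bsub>FIM X\<^esub> E' = E'" "E' \<otimes>\<^bsub>FIM X\<^esub> E = E'"
      using 3 E E' by (metis I.m_assoc I.m_closed)+
    then have "E = E'" using 1(1) by simp
    then show ?thesis using u E by (auto simp: E'_def)
  qed
  show ?thesis
  proof (rule I.inverse_monoidI)
    fix A assume "A \<in> carrier (FIM X)"
    then obtain u where "u \<in> words X" "A = rho X u" using rhoE by blast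
    then show "\<exists>B\<in>carrier (FIM X). A \<otimes>\<^bsub>FIM X\<^esub> B \<otimes>\<^bsub>FIM X\<^esub> A = A \<and> B \<otimes>\<^bsub>FIM X\<^esub> A \<otimes>\<^bsub>FIM X\<^esub> B = B"
      using reg reg' rho_in word_inv_in by metis
  next
    fix E F assume "E \<in> idempotents (FIM X)" "F \<in> idempotents (FIM X)"
    then show "E \<otimes>\<^bsub>FIM X\<^esub> F = F \<otimes>\<^bsub>FIM X\<^esub> E"
      using idem comm by metis
  qed
qed

lemma rho_in:
  assumes "w \<in> words X"
  shows "rho X w \<in> carrier (FIM X)"
proof -
  interpret F: monoid_with_congruence "free_monoid X" "vagner_congruence X"
    by (rule free_monoid_vagner)
  show ?thesis
    using assms F.class_in[of w] by (simp add: rho_def FIM_def free_monoid_def)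
qed

lemma FIM_presentation:
  assumes "R \<subseteq> words X \<times> words X"
  shows "inverse_monoid_with_congruence (FIM X) (presentation_congruence X R)"
proof -
  interpret inverse_monoid "FIM X" by (rule FIM_is_inverse_monoid)
  have "{(rho X l, rho X r) | l r. (l, r) \<in> R} \<subseteq> carrier (FIM X) \<times> carrier (FIM X)"
    using assms by (auto intro: rho_in)
  then show ?thesis
    by unfold_locales (simp add: presentation_congruence_def monoid_congruence_hull)
qed

section \<open>The congruence behind \<open>theta_min\<close>\<close>

context inverse_monoid_with_congruence
begin

text \<open>\<open>theta_min\<close> is the instance where \<open>r\<close> is the presentation
  congruence. The witnesses for transitivity, left and right multiplication are
  \<open>e \<otimes> f\<close>, \<open>e \<otimes> h\<close> and
  \<open>sinv G c \<otimes> e \<otimes> c\<close>.\<close>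

lemma minimal_congruence:
  "monoid_congruence G {(a, b). a \<in> carrier G \<and> b \<in> carrier G \<and>
     (\<exists>e \<in> idempotents G. a \<otimes> e = b \<otimes> e \<and>
        r `` {sinv G a \<otimes> a} = r `` {e} \<and> r `` {e} = r `` {sinv G b \<otimes> b})}"
  (is "monoid_congruence G ?m")
proof -
  define m where "m = ?m"
  \<comment> \<open>Equations between classes become memberships in \<open>r\<close>, the form to
    which the rules for \<open>r\<close> apply.\<close>
  have m_iff: "(a, b) \<in> m \<longleftrightarrow> a \<in> carrier G \<and> b \<in> carrier G \<and>
      (\<exists>e. e \<in> carrier G \<and> e \<otimes> e = e \<and> a \<otimes> e = b \<otimes> e \<and>
        (sinv G a \<otimes> a, e) \<in> r \<and> (sinv G b \<otimes> b, e) \<in> r)" for a b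
  proof (cases "a \<in> carrier G \<and> b \<in> carrier G")
    case True
    then have "r `` {sinv G a \<otimes> a} = r `` {e} \<longleftrightarrow> (sinv G a \<otimes> a, e) \<in> r"
      "r `` {e} = r `` {sinv G b \<otimes> b} \<longleftrightarrow> (sinv G b \<otimes> b, e) \<in> r"
      if "e \<in> carrier G" for e
      using that rel_sym[of e "sinv G b \<otimes> b"] rel_sym[of "sinv G b \<otimes> b" e]
      by (auto simp: class_eq_iff)
    then show ?thesis using True
      by (simp add: m_def idempotents_def Bex_def conj_assoc cong: conj_cong)
  qed (auto simp: m_def)
  have mE: "\<exists>e. e \<in> carrier G \<and> e \<otimes> e = e \<and> a \<otimes> e = b \<otimes> e \<and>
      (sinv G a \<otimes> a, e) \<in> r \<and> (sinv G b \<otimes> b, e) \<in> r \<and> a \<in> carrier G \<and> b \<in> carrier G"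
    if "(a, b) \<in> m" for a b
    using that unfolding m_iff by blast
  have mI: "(a, b) \<in> m"
    if "a \<in> carrier G" "b \<in> carrier G" "e \<in> carrier G" "e \<otimes> e = e" "a \<otimes> e = b \<otimes> e"
      "(sinv G a \<otimes> a, e) \<in> r" "(sinv G b \<otimes> b, e) \<in> r" for a b e
    using that unfolding m_iff by blast
  \<comment> \<open>x = x (x^-1 x) is related to x e for x = a and for x = b, and the two products
    with e agree. Left multiplication below depends on this inclusion of \<open>m\<close> in
    \<open>r\<close>.\<close>
  have m_rel: "(a, b) \<in> r" if ab: "(a, b) \<in> m" for a b
  proof -
    obtain e where e: "e \<in> carrier G" "a \<otimes> e = b \<otimes> e" "(sinv G a \<otimes> a, e) \<in> r"
      "(sinv G b \<otimes> b, e) \<in> r" and ab: "a \<in> carrier G" "b \<in> carrier G"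
      using mE[OF ab] by blast
    have "(x, x \<otimes> e) \<in> r" if "x \<in> carrier G" "(sinv G x \<otimes> x, e) \<in> r" for x
      using rel_mult[OF rel_refl[OF that(1)] that(2)] that(1)
      by (simp add: mult_sinv_mult flip: m_assoc)
    then show ?thesis using e ab by (metis rel_sym rel_trans)
  qed
  have "equiv (carrier G) m"
  proof (rule equivI)
    show "m \<subseteq> carrier G \<times> carrier G" using m_iff by auto
    show "refl_on (carrier G) m"
      using sinv_mult_idempotent
      by (auto intro!: refl_onI mI[OF _ _ _ _ refl rel_refl rel_refl] simp: idempotents_def)
    show "sym m" using m_iff by (metis symI)
    show "trans m"
    proof (rule transI)
      fix a b c assume ab: "(a, b) \<in> m" and bc: "(b, c) \<in> m"
      obtain e where e: "e \<in> carrier G" "e \<otimes> e = e" "a \<otimes> e = b \<otimes> e"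
          "(sinv G a \<otimes> a, e) \<in> r" "(sinv G b \<otimes> b, e) \<in> r"
        and abc: "a \<in> carrier G" "b \<in> carrier G"
        using mE[OF ab] by blast
      obtain f where f: "f \<in> carrier G" "f \<otimes> f = f" "b \<otimes> f = c \<otimes> f"
          "(sinv G b \<otimes> b, f) \<in> r" "(sinv G c \<otimes> c, f) \<in> r"
        and c: "c \<in> carrier G"
        using mE[OF bc] by blast
      note abc = abc c
      have ef: "e \<otimes> f = f \<otimes> e" "e \<otimes> f \<otimes> (e \<otimes> f) = e \<otimes> f"
        using idempotents_commute[of e f] idempotents_mult[of e f] e f
        by (auto simp: idempotents_def)
      \<comment> \<open>Both idempotents are related to b^-1 b, so their product is related to each
        of them.\<close>
      have ef_rel: "(e, f) \<in> r" using e(5) f(4) by (blast intro: rel_sym rel_trans)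
      have "(e, e \<otimes> f) \<in> r" using rel_mult[OF rel_refl[OF e(1)] ef_rel] e by simp
      moreover have "(f, e \<otimes> f) \<in> r"
        using rel_mult[OF rel_sym[OF ef_rel] rel_refl[OF f(1)]] f by simp
      moreover have "a \<otimes> (e \<otimes> f) = c \<otimes> (e \<otimes> f)"
        using e f abc ef(1) by (metis m_assoc)
      ultimately show "(a, c) \<in> m"
        using e f abc ef
        by (intro mI[of _ _ "e \<otimes> f"]) (auto intro: rel_trans)
    qed
  qed
  moreover have "(c \<otimes> a, c \<otimes> b) \<in> m" if ab: "(a, b) \<in> m" and c: "c \<in> carrier G" for a b c
  proof -
    obtain e where e: "e \<in> carrier G" "e \<otimes> e = e" "a \<otimes> e = b \<otimes> e"
        "(sinv G a \<otimes> a, e) \<in> r" "(sinv G b \<otimes> b, e) \<in> r"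
      and carr: "a \<in> carrier G" "b \<in> carrier G"
      using mE[OF ab] by blast
    \<comment> \<open>\<open>e\<close> is related to the domain idempotent of \<open>a\<close>, not
      to that of \<open>c \<otimes> a\<close>; the factor \<open>h\<close> repairs this.\<close>
    define h where "h = sinv G (c \<otimes> a) \<otimes> (c \<otimes> a)"
    have h: "h \<in> carrier G" "h \<otimes> h = h" "h \<in> idempotents G"
      using sinv_mult_idempotent[of "c \<otimes> a"] c carr by (auto simp: h_def idempotents_def)
    have eh: "e \<otimes> h \<in> carrier G" "e \<otimes> h \<otimes> (e \<otimes> h) = e \<otimes> h"
      using idempotents_mult[of e h] e h by (auto simp: idempotents_def)
    have "c \<otimes> a \<otimes> (e \<otimes> h) = c \<otimes> (a \<otimes> e) \<otimes> h"
      using c carr e(1) h(1) by (simp add: m_assoc)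
    also have "\<dots> = c \<otimes> b \<otimes> (e \<otimes> h)"
      unfolding e(3) using c carr e(1) h(1) by (simp add: m_assoc)
    finally have 1: "c \<otimes> a \<otimes> (e \<otimes> h) = c \<otimes> b \<otimes> (e \<otimes> h)" .
    \<comment> \<open>\<open>h\<close> lies below a^-1 a and absorbs it; replacing a^-1 a by the
      related \<open>e\<close> shows that \<open>h\<close> is related to
      \<open>e \<otimes> h\<close>.\<close>
    have "sinv G a \<otimes> a \<otimes> h = (sinv G a \<otimes> a \<otimes> sinv G a) \<otimes> sinv G c \<otimes> (c \<otimes> a)"
      using c carr by (simp add: h_def sinv_mult m_assoc)
    also have "\<dots> = h"
      using c carr by (simp add: h_def sinv_mult_sinv sinv_mult)
    finally have 2: "(h, e \<otimes> h) \<in> r"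
      using rel_mult[OF e(4) rel_refl[OF h(1)]] by simp
    \<comment> \<open>Here \<open>m_rel\<close> enters: related elements have related domain
      idempotents by \<open>rel_sinv\<close>, so \<open>h\<close> also stands for that of
      \<open>c \<otimes> b\<close>.\<close>
    have "(c \<otimes> b, c \<otimes> a) \<in> r"
      using m_rel[OF ab] c by (blast intro: rel_mult rel_refl rel_sym)
    then have "(sinv G (c \<otimes> b) \<otimes> (c \<otimes> b), h) \<in> r"
      unfolding h_def by (blast intro: rel_mult rel_sinv)
    then show ?thesis
      using 1 2 eh c carr rel_trans by (intro mI[of _ _ "e \<otimes> h"]) (auto simp: h_def)
  qed
  moreover have "(a \<otimes> c, b \<otimes> c) \<in> m" if ab: "(a, b) \<in> m" and c: "c \<in> carrier G" for a b c
  proof -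
    obtain e where e: "e \<in> carrier G" "e \<otimes> e = e" "a \<otimes> e = b \<otimes> e"
        "(sinv G a \<otimes> a, e) \<in> r" "(sinv G b \<otimes> b, e) \<in> r"
      and carr: "a \<in> carrier G" "b \<in> carrier G"
      using mE[OF ab] by blast
    \<comment> \<open>Conjugation lets \<open>e\<close> pass \<open>c\<close>, in the form
      \<open>c \<otimes> f = e \<otimes> c\<close>. The domain idempotent of
      \<open>x \<otimes> c\<close> is the same conjugate of that of \<open>x\<close>.\<close>
    define f where "f = sinv G c \<otimes> e \<otimes> c"
    have f: "f \<in> carrier G" using c e by (simp add: f_def)
    have comm: "c \<otimes> sinv G c \<otimes> e = e \<otimes> (c \<otimes> sinv G c)"
      using idempotents_commute[of "c \<otimes> sinv G c" e] mult_sinv_idempotent[OF c] e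
      by (simp add: idempotents_def)
    have cf: "c \<otimes> f = e \<otimes> c"
    proof -
      have "c \<otimes> f = c \<otimes> sinv G c \<otimes> e \<otimes> c"
        using c e(1) by (simp add: f_def m_assoc)
      also have "\<dots> = e \<otimes> (c \<otimes> sinv G c \<otimes> c)"
        unfolding comm using c e(1) by (simp add: m_assoc)
      finally show ?thesis using c by (simp add: mult_sinv_mult)
    qed
    have "f \<otimes> f = sinv G c \<otimes> e \<otimes> (c \<otimes> f)"
      using c e(1) by (simp add: f_def m_assoc)
    also have "\<dots> = sinv G c \<otimes> (e \<otimes> e) \<otimes> c"
      unfolding cf using c e(1) by (simp add: m_assoc)
    finally have ff: "f \<otimes> f = f" using e by (simp add: f_def)
    have af: "a \<otimes> c \<otimes> f = b \<otimes> c \<otimes> f"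
      using c carr e f cf by (metis m_assoc)
    have "(sinv G (x \<otimes> c) \<otimes> (x \<otimes> c), f) \<in> r"
      if "x \<in> carrier G" "(sinv G x \<otimes> x, e) \<in> r" for x
    proof -
      have "sinv G (x \<otimes> c) \<otimes> (x \<otimes> c) = sinv G c \<otimes> (sinv G x \<otimes> x) \<otimes> c"
        using that c by (simp add: sinv_mult m_assoc)
      then show ?thesis
        using that c by (simp add: f_def rel_mult rel_refl)
    qed
    then show ?thesis
      using c carr e f ff af by (intro mI[of _ _ f]) auto
  qed
  ultimately have "monoid_congruence G m"
    unfolding monoid_congruence_def by (intro conjI allI impI) simp_all
  then show ?thesis by (simp only: m_def)
qed

end

lemma FIM_theta_min:
  assumes "R \<subseteq> words X \<times> words X"
  shows "inverse_monoid_with_congruence (FIM X) (theta_min X R)"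
proof -
  interpret inverse_monoid_with_congruence "FIM X" "presentation_congruence X R"
    by (rule FIM_presentation[OF assms])
  show ?thesis
    using minimal_congruence by unfold_locales (simp add: theta_min_def theta_def)
qed

lemma vertex_monoid_is_inverse_monoid:
  "R \<subseteq> words X \<times> words X \<Longrightarrow> inverse_monoid (vertex_monoid X R)"
  unfolding vertex_monoid_def
  by (rule inverse_monoid_with_congruence.quotient_is_inverse_monoid[OF FIM_theta_min])

lemma tau_rho_in:
  assumes "R \<subseteq> words X \<times> words X" "w \<in> words X"
  shows "tau X R (rho X w) \<in> carrier (vertex_monoid X R)"
proof -
  interpret inverse_monoid_with_congruence "FIM X" "theta_min X R"
    by (rule FIM_theta_min[OF assms(1)])
  show ?thesis using class_in[OF rho_in[OF assms(2)]] by (simp add: tau_def vertex_monoid_def)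
qed

section \<open>Groupoids with actions\<close>

context groupoid
begin

text \<open>A relation, since the locale only asserts that inverses exist; the actions then preserve
  it without any comparison of chosen inverses.\<close>

definition inverse_arrows where
  "inverse_arrows \<alpha> \<beta> \<longleftrightarrow> \<alpha> \<in> Arr G \<and> \<beta> \<in> Arr G \<and> dm G \<beta> = rg G \<alpha> \<and> rg G \<beta> = dm G \<alpha> \<and>
     cmp G \<alpha> \<beta> = idn G (dm G \<alpha>) \<and> cmp G \<beta> \<alpha> = idn G (rg G \<alpha>)"

text \<open>Compose the square with \<open>a'\<close> on the left and \<open>d'\<close> on the
  right. This turns interchange for an arrow into interchange for its inverse.\<close>

lemma square_flip:
  assumes arr: "a \<in> Arr G" "b \<in> Arr G" "c \<in> Arr G" "d \<in> Arr G"
    and ends: "rg G a = dm G b" "dm G c = dm G a" "rg G c = dm G d" "rg G b = rg G d"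
    and square: "cmp G a b = cmp G c d"
    and inv: "inverse_arrows a a'" "inverse_arrows d d'"
  shows "cmp G a' c = cmp G b d'"
proof -
  have a': "a' \<in> Arr G" "dm G a' = rg G a" "rg G a' = dm G a" "cmp G a' a = idn G (rg G a)"
    and d': "d' \<in> Arr G" "dm G d' = rg G d" "rg G d' = dm G d" "cmp G d d' = idn G (dm G d)"
    using inv by (auto simp: inverse_arrows_def)
  have "cmp G a' c = cmp G a' (cmp G c (cmp G d d'))"
    using arr(3) ends(3) d'(4) by (metis cmp_idn_right)
  also have "\<dots> = cmp G a' (cmp G (cmp G c d) d')"
    using arr ends d' by (simp add: cmp_assoc)
  also have "\<dots> = cmp G a' (cmp G a (cmp G b d'))"
    unfolding square[symmetric] using arr ends d' by (simp add: cmp_assoc)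
  also have "\<dots> = cmp G (cmp G a' a) (cmp G b d')"
    by (rule cmp_assoc[symmetric]) (use arr ends a' d' in \<open>simp_all add: cmp_in dm_cmp\<close>)
  also have "\<dots> = cmp G b d'"
    using arr ends a'(4) d' by (metis cmp_idn_left cmp_in dm_cmp)
  finally show ?thesis .
qed

end

section \<open>Closure properties of interchange\<close>

context semiregular_groupoid
begin

text \<open>The monoidal law for a single pair of arrows, so that it can spread from generators to
  all arrows.\<close>

definition interchanges where
  "interchanges \<alpha> \<beta> \<longleftrightarrow>
     cmp G (ra \<alpha> (dm G \<beta>)) (la (rg G \<alpha>) \<beta>) = cmp G (la (dm G \<alpha>) \<beta>) (ra \<alpha> (rg G \<beta>))"

lemmas action_simps = dm_in rg_in la_in ra_in dm_la dm_ra rg_la rg_ra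

lemma inverse_arrows_la:
  assumes "inverse_arrows \<alpha> \<beta>" "x \<in> Vert G"
  shows "inverse_arrows (la x \<alpha>) (la x \<beta>)"
  using assms unfolding inverse_arrows_def
  by (auto simp: action_simps la_idn simp flip: la_cmp)

lemma inverse_arrows_ra:
  assumes "inverse_arrows \<alpha> \<beta>" "x \<in> Vert G"
  shows "inverse_arrows (ra \<alpha> x) (ra \<beta> x)"
  using assms unfolding inverse_arrows_def
  by (auto simp: action_simps ra_idn simp flip: ra_cmp)

lemma interchanges_idn_left:
  assumes "x \<in> Vert G" "\<beta> \<in> Arr G"
  shows "interchanges (idn G x) \<beta>"
  using assms cmp_idn_left[of "la x \<beta>"] cmp_idn_right[of "la x \<beta>"]
  by (simp add: interchanges_def ra_idn dm_idn rg_idn action_simps)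

lemma interchanges_idn_right:
  assumes "\<alpha> \<in> Arr G" "x \<in> Vert G"
  shows "interchanges \<alpha> (idn G x)"
  using assms cmp_idn_left[of "ra \<alpha> x"] cmp_idn_right[of "ra \<alpha> x"]
  by (simp add: interchanges_def la_idn dm_idn rg_idn action_simps)

text \<open>Pasting: \<open>\<beta>\<close> is carried past \<open>\<alpha>'\<close> and then past
  \<open>\<alpha>\<close>; the two squares share the side
  \<open>la (rg G \<alpha>) \<beta>\<close>.\<close>

lemma interchanges_cmp_left:
  assumes a: "\<alpha> \<in> Arr G" and a': "\<alpha>' \<in> Arr G" and b: "\<beta> \<in> Arr G"
    and end1: "rg G \<alpha> = dm G \<alpha>'" and 1: "interchanges \<alpha> \<beta>" and 2: "interchanges \<alpha>' \<beta>"
  shows "interchanges (cmp G \<alpha> \<alpha>') \<beta>"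
proof -
  note arr = a a' b
  let ?x = "dm G \<beta>" and ?y = "rg G \<beta>"
  have "cmp G (ra (cmp G \<alpha> \<alpha>') ?x) (la (rg G \<alpha>') \<beta>)
      = cmp G (ra \<alpha> ?x) (cmp G (ra \<alpha>' ?x) (la (rg G \<alpha>') \<beta>))"
    using arr end1 by (simp add: ra_cmp cmp_assoc action_simps)
  also have "\<dots> = cmp G (cmp G (ra \<alpha> ?x) (la (rg G \<alpha>) \<beta>)) (ra \<alpha>' ?y)"
    using arr end1 2 by (simp add: interchanges_def cmp_assoc action_simps)
  also have "\<dots> = cmp G (la (dm G \<alpha>) \<beta>) (ra (cmp G \<alpha> \<alpha>') ?y)"
    using arr end1 1 unfolding interchanges_def by (simp add: ra_cmp cmp_assoc action_simps)
  finally show ?thesis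
    using arr end1 by (simp add: interchanges_def dm_cmp rg_cmp)
qed

text \<open>Pasting in the other direction, along the side
  \<open>ra \<alpha> (dm G \<beta>')\<close>.\<close>

lemma interchanges_cmp_right:
  assumes a: "\<alpha> \<in> Arr G" and b: "\<beta> \<in> Arr G" and b': "\<beta>' \<in> Arr G"
    and end1: "rg G \<beta> = dm G \<beta>'" and 1: "interchanges \<alpha> \<beta>" and 2: "interchanges \<alpha> \<beta>'"
  shows "interchanges \<alpha> (cmp G \<beta> \<beta>')"
proof -
  note arr = a b b'
  let ?x = "dm G \<alpha>" and ?y = "rg G \<alpha>"
  have "cmp G (ra \<alpha> (dm G \<beta>)) (la ?y (cmp G \<beta> \<beta>'))
      = cmp G (cmp G (ra \<alpha> (dm G \<beta>)) (la ?y \<beta>)) (la ?y \<beta>')"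
    using arr end1 by (simp add: la_cmp cmp_assoc action_simps)
  also have "\<dots> = cmp G (la ?x \<beta>) (cmp G (ra \<alpha> (dm G \<beta>')) (la ?y \<beta>'))"
    using arr end1 1 unfolding interchanges_def by (simp add: cmp_assoc action_simps)
  also have "\<dots> = cmp G (la ?x (cmp G \<beta> \<beta>')) (ra \<alpha> (rg G \<beta>'))"
    using arr end1 2 by (simp add: interchanges_def la_cmp cmp_assoc action_simps)
  finally show ?thesis
    using arr end1 by (simp add: interchanges_def dm_cmp rg_cmp)
qed

text \<open>The interchange square of \<open>\<alpha>\<close> and \<open>\<beta>\<close> is flipped
  along its two \<open>\<beta>\<close> sides, which inverts the two \<open>\<alpha>\<close>
  sides.\<close>

lemma interchanges_inverse_left:
  assumes inv: "inverse_arrows \<alpha> \<alpha>'" and b: "\<beta> \<in> Arr G" and 1: "interchanges \<alpha> \<beta>"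
  shows "interchanges \<alpha>' \<beta>"
proof -
  have a: "\<alpha> \<in> Arr G" "dm G \<alpha>' = rg G \<alpha>" "rg G \<alpha>' = dm G \<alpha>"
    using inv by (auto simp: inverse_arrows_def)
  have "cmp G (ra \<alpha>' (dm G \<beta>)) (la (dm G \<alpha>) \<beta>) = cmp G (la (rg G \<alpha>) \<beta>) (ra \<alpha>' (rg G \<beta>))"
    by (rule square_flip[OF _ _ _ _ _ _ _ _ 1[unfolded interchanges_def]])
      (use a b inv in \<open>simp_all add: action_simps inverse_arrows_ra\<close>)
  then show ?thesis by (simp add: interchanges_def a)
qed

text \<open>The square equation is taken in reverse, so that the sides inverted by
  \<open>square_flip\<close> are the translates of \<open>\<beta>\<close>.\<close>

lemma interchanges_inverse_right:
  assumes inv: "inverse_arrows \<beta> \<beta>'" and a: "\<alpha> \<in> Arr G" and 1: "interchanges \<alpha> \<beta>"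
  shows "interchanges \<alpha> \<beta>'"
proof -
  have b: "\<beta> \<in> Arr G" "dm G \<beta>' = rg G \<beta>" "rg G \<beta>' = dm G \<beta>"
    using inv by (auto simp: inverse_arrows_def)
  have "cmp G (la (dm G \<alpha>) \<beta>') (ra \<alpha> (dm G \<beta>)) = cmp G (ra \<alpha> (rg G \<beta>)) (la (rg G \<alpha>) \<beta>')"
    by (rule square_flip[OF _ _ _ _ _ _ _ _ 1[unfolded interchanges_def, symmetric]])
      (use a b inv in \<open>simp_all add: action_simps inverse_arrows_la\<close>)
  then show ?thesis by (simp add: interchanges_def b)
qed

end

section \<open>The fundamental groupoid of a 2-complex\<close>

lemma is_path_verts: "is_path K u es v \<Longrightarrow> u \<in> verts K \<and> v \<in> verts K"
  by (induction es arbitrary: u) auto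

lemma is_path_append:
  "is_path K u (es @ fs) v \<longleftrightarrow> (\<exists>w. is_path K u es w \<and> is_path K w fs v)"
  by (induction es arbitrary: u) (auto dest: is_path_verts)

lemma reverse_edge_reverse_edge [simp]: "reverse_edge (reverse_edge a) = a"
  by (cases a) simp

lemma fst_reverse_edge [simp]: "fst (reverse_edge a) = fst a"
  by (cases a) simp

lemma start_of_reverse_edge [simp]: "start_of K (reverse_edge a) = end_of K a"
  and end_of_reverse_edge [simp]: "end_of K (reverse_edge a) = start_of K a"
  by (cases a; simp)+

text \<open>Conditions that the record type leaves open. \<open>cell_paths\<close> keeps
  \<open>homotopy\<close> among genuine paths with equal end points.\<close>

locale wf_two_complex =
  fixes K :: "('v, 'e) two_complex"
  assumes src_in: "e \<in> edges K \<Longrightarrow> src K e \<in> verts K"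
    and tgt_in: "e \<in> edges K \<Longrightarrow> tgt K e \<in> verts K"
    and cell_paths: "(x, P, Q, y) \<in> cells K \<Longrightarrow> is_path K x P y \<and> is_path K x Q y"
begin

abbreviation "\<P> \<equiv> fundamental_groupoid K"

abbreviation "cls u es v \<equiv> path_class K (u, es, v)"

lemma signed_edge_in: "fst a \<in> edges K \<Longrightarrow> start_of K a \<in> verts K \<and> end_of K a \<in> verts K"
  by (cases a) (simp add: src_in tgt_in)

lemma homotopy_ends:
  assumes "(p, q) \<in> homotopy K"
  shows "p \<in> paths K \<and> q \<in> paths K \<and> fst p = fst q \<and> snd (snd p) = snd (snd q)"
  using assms
proof induction
  case (homotopy_cancel u as a bs v)
  then show ?case
    by (auto simp: paths_def is_path_append)
next
  case (homotopy_cell x P Q y u as bs v)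
  then show ?case
    using cell_paths[OF homotopy_cell(1)] by (auto simp: paths_def is_path_append)
qed auto

lemma equiv_homotopy: "equiv (paths K) (homotopy K)"
proof (rule equivI)
  show "homotopy K \<subseteq> paths K \<times> paths K" using homotopy_ends by auto
qed (auto intro: refl_onI symI transI homotopy.intros)

text \<open>End points and edge lists are written as projections so that rule induction runs over
  arbitrary pairs of paths; \<open>homotopy_whisker\<close> is the form for use.\<close>

lemma homotopy_whisker_aux:
  assumes "(p, q) \<in> homotopy K" "is_path K t es (fst p)" "is_path K (snd (snd p)) fs w"
  shows "((t, es @ fst (snd p) @ fs, w), (t, es @ fst (snd q) @ fs, w)) \<in> homotopy K"
  using assms
proof induction
  case (homotopy_refl p)
  then have "(t, es @ fst (snd p) @ fs, w) \<in> paths K"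
    by (cases p) (simp add: paths_def is_path_append, blast)
  then show ?case by (rule homotopy.homotopy_refl)
next
  case (homotopy_sym p q)
  then show ?case using homotopy_ends[of p q] by (simp add: homotopy.homotopy_sym)
next
  case (homotopy_trans p q r)
  then show ?case using homotopy_ends[of p q] by (metis homotopy.homotopy_trans)
next
  case (homotopy_cancel u as a bs v)
  then have "(t, (es @ as) @ [a, reverse_edge a] @ (bs @ fs), w) \<in> paths K"
    by (auto simp: paths_def is_path_append)
  from homotopy.homotopy_cancel[OF this] show ?case by simp
next
  case (homotopy_cell x P Q y u as bs v)
  then have "is_path K t (es @ as) x" "is_path K y (bs @ fs) w"
    by (auto simp: is_path_append)
  from homotopy.homotopy_cell[OF homotopy_cell(1) this] show ?case by simp
qed

lemma homotopy_whisker: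
  assumes "((u, as, v), (u, bs, v)) \<in> homotopy K" "is_path K t es u" "is_path K v fs w"
  shows "((t, es @ as @ fs, w), (t, es @ bs @ fs, w)) \<in> homotopy K"
  using homotopy_whisker_aux[OF assms(1)] assms(2,3) by simp

text \<open>Induction contracts the inner loop by whiskering, after which the outer letter meets its
  reverse and cancels.\<close>

lemma homotopy_reverse:
  assumes "is_path K u es v"
  shows "is_path K v (rev (map reverse_edge es)) u \<and>
    ((u, es @ rev (map reverse_edge es), u), (u, [], u)) \<in> homotopy K"
  using assms
proof (induction es arbitrary: u)
  case Nil
  then show ?case by (auto simp: paths_def intro: homotopy_refl)
next
  case (Cons a es)
  let ?r = "rev (map reverse_edge es)"
  have a: "u \<in> verts K" "fst a \<in> edges K" "start_of K a = u" "is_path K (end_of K a) es v"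
    using Cons.prems by auto
  have IH: "is_path K v ?r (end_of K a)"
    "((end_of K a, es @ ?r, end_of K a), (end_of K a, [], end_of K a)) \<in> homotopy K"
    using Cons.IH[OF a(4)] by auto
  have ends: "is_path K u [a] (end_of K a)" "is_path K (end_of K a) [reverse_edge a] u"
    using a signed_edge_in[OF a(2)] by auto
  have "((u, [a] @ (es @ ?r) @ [reverse_edge a], u), (u, [a] @ [] @ [reverse_edge a], u))
      \<in> homotopy K"
    by (rule homotopy_whisker[OF IH(2) ends])
  moreover have "((u, [] @ [a, reverse_edge a] @ [], u), (u, [] @ [], u)) \<in> homotopy K"
    by (rule homotopy_cancel) (use ends a in \<open>auto simp: paths_def\<close>)
  ultimately have "((u, (a # es) @ rev (map reverse_edge (a # es)), u), (u, [], u)) \<in> homotopy K"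
    by (auto intro: homotopy_trans)
  moreover have "is_path K v (rev (map reverse_edge (a # es))) u"
    using IH(1) ends(2) by (simp add: is_path_append del: is_path.simps) blast
  ultimately show ?case by blast
qed

section \<open>Homotopy classes as the arrows of a groupoid\<close>

lemma cls_eq_iff:
  assumes "is_path K u es v" "is_path K u fs v"
  shows "cls u es v = cls u fs v \<longleftrightarrow> ((u, es, v), (u, fs, v)) \<in> homotopy K"
  unfolding path_class_def by (rule eq_equiv_class_iff[OF equiv_homotopy])
    (use assms in \<open>auto simp: paths_def\<close>)

lemma cls_cell:
  assumes "(x, P, Q, y) \<in> cells K"
  shows "cls x P y = cls x Q y"
proof -
  note PQ = cell_paths[OF assms]
  then have "is_path K x [] x" "is_path K y [] y"
    by (auto dest: is_path_verts)
  then have "((x, [] @ P @ [], y), (x, [] @ Q @ [], y)) \<in> homotopy K"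
    by (rule homotopy_cell[OF assms])
  then show ?thesis using PQ by (simp add: cls_eq_iff)
qed

lemma path_in_cls: "is_path K u es v \<Longrightarrow> (u, es, v) \<in> cls u es v"
  unfolding path_class_def by (auto simp: paths_def intro: homotopy_refl)

lemma in_clsE:
  assumes "p \<in> cls u es v"
  obtains fs where "p = (u, fs, v)" "is_path K u fs v" "cls u fs v = cls u es v"
proof -
  have h: "((u, es, v), p) \<in> homotopy K" using assms by (simp add: path_class_def)
  obtain x fs y where p: "p = (x, fs, y)" by (cases p)
  show thesis
    using h homotopy_ends[OF h] equiv_class_eq[OF equiv_homotopy h] p
    by (intro that[of fs]) (auto simp: paths_def path_class_def)
qed

lemma cls_in: "is_path K u es v \<Longrightarrow> cls u es v \<in> Arr \<P>"
  by (auto simp: fundamental_groupoid_def path_class_def paths_def intro: quotientI)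

lemma ArrE:
  assumes "\<alpha> \<in> Arr \<P>"
  obtains u es v where "is_path K u es v" "\<alpha> = cls u es v"
  using assms by (auto simp: fundamental_groupoid_def path_class_def paths_def elim: quotientE)

lemma dm_cls: "is_path K u es v \<Longrightarrow> dm \<P> (cls u es v) = u"
proof -
  assume "is_path K u es v"
  then have "(\<lambda>(u, es, v). u) ` cls u es v = {u}"
    using path_in_cls by (force elim: in_clsE)
  then show ?thesis by (simp add: fundamental_groupoid_def)
qed

lemma rg_cls: "is_path K u es v \<Longrightarrow> rg \<P> (cls u es v) = v"
proof -
  assume "is_path K u es v"
  then have "(\<lambda>(u, es, v). v) ` cls u es v = {v}"
    using path_in_cls by (force elim: in_clsE)
  then show ?thesis by (simp add: fundamental_groupoid_def)
qed

lemma idn_eq: "idn \<P> u = cls u [] u"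
  by (simp add: fundamental_groupoid_def)

lemma Vert_eq: "Vert \<P> = verts K"
  by (simp add: fundamental_groupoid_def)

text \<open>One factor is changed at a time, by whiskering with the other.\<close>

lemma cls_append_cong:
  assumes "is_path K u es v" "is_path K u es' v" "is_path K v fs w" "is_path K v fs' w"
    and "cls u es v = cls u es' v" "cls v fs w = cls v fs' w"
  shows "cls u (es @ fs) w = cls u (es' @ fs') w"
proof -
  have "((u, [] @ es @ fs, w), (u, [] @ es' @ fs, w)) \<in> homotopy K"
    by (rule homotopy_whisker) (use assms in \<open>auto simp: cls_eq_iff dest: is_path_verts\<close>)
  moreover have "((u, es' @ fs @ [], w), (u, es' @ fs' @ [], w)) \<in> homotopy K"
    by (rule homotopy_whisker) (use assms in \<open>auto simp: cls_eq_iff dest: is_path_verts\<close>)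
  ultimately show ?thesis
    using assms by (subst cls_eq_iff) (auto simp: is_path_append intro: homotopy_trans)
qed

lemma cmp_cls:
  assumes "is_path K u es v" "is_path K v fs w"
  shows "cmp \<P> (cls u es v) (cls v fs w) = cls u (es @ fs) w"
proof -
  have inner: "path_class K (path_concat p q) = cls u (es @ fs) w"
    if p: "p \<in> cls u es v" and q: "q \<in> cls v fs w" for p q
  proof -
    obtain es' where es': "p = (u, es', v)" "is_path K u es' v" "cls u es' v = cls u es v"
      by (rule in_clsE[OF p])
    obtain fs' where fs': "q = (v, fs', w)" "is_path K v fs' w" "cls v fs' w = cls v fs w"
      by (rule in_clsE[OF q])
    show ?thesis
      using cls_append_cong[OF es'(2) assms(1) fs'(2) assms(2) es'(3) fs'(3)] es'(1) fs'(1)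
      by simp
  qed
  have "(\<Union>p\<in>cls u es v. \<Union>q\<in>cls v fs w. path_class K (path_concat p q)) = cls u (es @ fs) w"
    using path_in_cls assms by (intro SUP_eq_const) (auto simp: inner)
  then show ?thesis by (simp add: fundamental_groupoid_def)
qed

lemma inverse_cls:
  assumes p: "is_path K u es v"
  shows "cmp \<P> (cls u es v) (cls v (rev (map reverse_edge es)) u) = idn \<P> u"
    and "cmp \<P> (cls v (rev (map reverse_edge es)) u) (cls u es v) = idn \<P> v"
proof -
  note r = homotopy_reverse[OF p]
  have uv: "is_path K u [] u" "is_path K v [] v" using is_path_verts[OF p] by auto
  \<comment> \<open>Reversal is an involution, so the second inverse law is the first one for the
    reversed path.\<close>
  have "rev (map reverse_edge (rev (map reverse_edge es))) = es"
    by (simp add: rev_map o_def)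
  then have r': "((v, rev (map reverse_edge es) @ es, v), (v, [], v)) \<in> homotopy K"
    using homotopy_reverse[of v "rev (map reverse_edge es)" u] r by simp
  show "cmp \<P> (cls u es v) (cls v (rev (map reverse_edge es)) u) = idn \<P> u"
    using p r uv is_path_append[of K u es "rev (map reverse_edge es)" u]
    by (metis cmp_cls idn_eq cls_eq_iff)
  show "cmp \<P> (cls v (rev (map reverse_edge es)) u) (cls u es v) = idn \<P> v"
    using p r r' uv is_path_append[of K v "rev (map reverse_edge es)" es v]
    by (metis cmp_cls idn_eq cls_eq_iff)
qed

sublocale groupoid \<P>
proof
  fix \<alpha> assume a: "\<alpha> \<in> Arr \<P>"
  then obtain u es v where p: "is_path K u es v" "\<alpha> = cls u es v" by (rule ArrE)
  have uv: "is_path K u [] u" "is_path K v [] v" using is_path_verts[OF p(1)] by auto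
  show "dm \<P> \<alpha> \<in> Vert \<P>" "rg \<P> \<alpha> \<in> Vert \<P>"
    using p uv by (simp_all add: Vert_eq dm_cls rg_cls)
  show "cmp \<P> (idn \<P> (dm \<P> \<alpha>)) \<alpha> = \<alpha>" "cmp \<P> \<alpha> (idn \<P> (rg \<P> \<alpha>)) = \<alpha>"
    using p uv by (simp_all add: dm_cls rg_cls idn_eq cmp_cls)
  show "\<exists>\<beta>\<in>Arr \<P>. dm \<P> \<beta> = rg \<P> \<alpha> \<and> rg \<P> \<beta> = dm \<P> \<alpha> \<and>
      cmp \<P> \<alpha> \<beta> = idn \<P> (dm \<P> \<alpha>) \<and> cmp \<P> \<beta> \<alpha> = idn \<P> (rg \<P> \<alpha>)"
    using p homotopy_reverse[OF p(1)] inverse_cls[OF p(1)]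
    by (intro bexI[of _ "cls v (rev (map reverse_edge es)) u"])
      (simp_all add: dm_cls rg_cls cls_in)
next
  fix \<alpha> \<beta> assume "\<alpha> \<in> Arr \<P>" "\<beta> \<in> Arr \<P>" and ends: "rg \<P> \<alpha> = dm \<P> \<beta>"
  then obtain u es v v' fs w where
    "is_path K u es v" "\<alpha> = cls u es v" "is_path K v' fs w" "\<beta> = cls v' fs w"
    by (metis ArrE)
  then show "cmp \<P> \<alpha> \<beta> \<in> Arr \<P>" "dm \<P> (cmp \<P> \<alpha> \<beta>) = dm \<P> \<alpha>" "rg \<P> (cmp \<P> \<alpha> \<beta>) = rg \<P> \<beta>"
    using ends is_path_append[of K u es fs w] by (auto simp: dm_cls rg_cls cmp_cls cls_in)
next
  fix \<alpha> \<beta> \<gamma> assume "\<alpha> \<in> Arr \<P>" "\<beta> \<in> Arr \<P>" "\<gamma> \<in> Arr \<P>"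
    and ends: "rg \<P> \<alpha> = dm \<P> \<beta>" "rg \<P> \<beta> = dm \<P> \<gamma>"
  then obtain u es v v' fs w w' gs x where
    "is_path K u es v" "\<alpha> = cls u es v" "is_path K v' fs w" "\<beta> = cls v' fs w"
    "is_path K w' gs x" "\<gamma> = cls w' gs x"
    by (metis ArrE)
  then show "cmp \<P> (cmp \<P> \<alpha> \<beta>) \<gamma> = cmp \<P> \<alpha> (cmp \<P> \<beta> \<gamma>)"
    using ends is_path_append[of K u es fs w] is_path_append[of K v fs gs x]
    by (auto simp: dm_cls rg_cls cmp_cls)
next
  fix x assume "x \<in> Vert \<P>"
  then have "is_path K x [] x" by (simp add: Vert_eq)
  then show "idn \<P> x \<in> Arr \<P>" "dm \<P> (idn \<P> x) = x" "rg \<P> (idn \<P> x) = x"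
    by (simp_all add: idn_eq cls_in dm_cls rg_cls)
qed

lemma edge_path: "e \<in> edges K \<Longrightarrow> is_path K (src K e) [(e, True)] (tgt K e)"
  by (simp add: src_in tgt_in)

text \<open>Arrows are generated by edges: a path is a product of signed edges, and a negatively
  signed edge gives an inverse of an edge class. This is what reduces interchange to edges.\<close>

lemma Arr_induct [consumes 1, case_names idn edge inverse cmp]:
  assumes "\<alpha> \<in> Arr \<P>"
    and idn: "\<And>x. x \<in> verts K \<Longrightarrow> P (idn \<P> x)"
    and edge: "\<And>e. e \<in> edges K \<Longrightarrow> P (edge_class K e)"
    and inverse: "\<And>\<beta> \<gamma>. inverse_arrows \<beta> \<gamma> \<Longrightarrow> P \<beta> \<Longrightarrow> P \<gamma>"
    and cmp: "\<And>\<beta> \<gamma>. \<lbrakk>\<beta> \<in> Arr \<P>; \<gamma> \<in> Arr \<P>; rg \<P> \<beta> = dm \<P> \<gamma>; P \<beta>; P \<gamma>\<rbrakk> \<Longrightarrow> P (cmp \<P> \<beta> \<gamma>)"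
  shows "P \<alpha>"
proof -
  have "P (cls u es v)" if "is_path K u es v" for u es v
    using that
  proof (induction es arbitrary: u)
    case Nil
    then show ?case using idn by (auto simp: idn_eq)
  next
    case (Cons a es)
    obtain e b where a: "a = (e, b)" by (cases a)
    have e: "e \<in> edges K" "start_of K a = u" and es: "is_path K (end_of K a) es v"
      using Cons.prems a by auto
    have path: "is_path K u [a] (end_of K a)"
      using e a src_in tgt_in by auto
    have "P (cls u [a] (end_of K a))"
    proof (cases b)
      case True
      then show ?thesis using edge[OF e(1)] e(2) a by (auto simp: edge_class_def)
    next
      case False
      then have ends: "tgt K e = u" "end_of K a = src K e" using a e by auto
      \<comment> \<open>The negative letter is displayed as the reversal of a one-edge path, the
        shape that \<open>inverse_cls\<close> handles.\<close>
      have rev_eq: "rev (map reverse_edge [(e, True)]) = [a]" using a False by simp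
      have "inverse_arrows (edge_class K e) (cls u [a] (end_of K a))"
        using edge_path[OF e(1)] inverse_cls[OF edge_path[OF e(1)]] path ends
        unfolding inverse_arrows_def edge_class_def rev_eq
        by (simp add: dm_cls rg_cls cls_in del: is_path.simps)
      then show ?thesis using inverse edge[OF e(1)] by blast
    qed
    then have "P (cmp \<P> (cls u [a] (end_of K a)) (cls (end_of K a) es v))"
      using Cons.IH[OF es] path es
      by (intro cmp) (simp_all add: dm_cls rg_cls cls_in del: is_path.simps)
    then show ?case using cmp_cls[OF path es] by simp
  qed
  then show ?thesis using assms(1) by (auto elim: ArrE)
qed

end

section \<open>Functors induced by endomorphisms of a 2-complex\<close>

locale two_complex_endomorphism = wf_two_complex K for K :: "('v, 'e) two_complex" +
  fixes f :: "'v \<Rightarrow> 'v" and g :: "'e \<Rightarrow> 'e"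
  assumes vert_map: "x \<in> verts K \<Longrightarrow> f x \<in> verts K"
    and edge_map: "e \<in> edges K \<Longrightarrow> g e \<in> edges K"
    and src_map: "e \<in> edges K \<Longrightarrow> src K (g e) = f (src K e)"
    and tgt_map: "e \<in> edges K \<Longrightarrow> tgt K (g e) = f (tgt K e)"
    and cell_map: "(x, P, Q, y) \<in> cells K \<Longrightarrow>
      (f x, map (map_prod g id) P, map (map_prod g id) Q, f y) \<in> cells K"
begin

lemma path_map: "is_path K u es v \<Longrightarrow> is_path K (f u) (map (map_prod g id) es) (f v)"
  by (induction es arbitrary: u) (auto simp: vert_map edge_map src_map tgt_map split: if_splits)

lemma reverse_edge_map: "reverse_edge (map_prod g id a) = map_prod g id (reverse_edge a)"
  by (cases a) simp

text \<open>Signs are kept and cells go to cells, so each generating homotopy is sent to one of the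
  same kind.\<close>

lemma homotopy_map:
  "(p, q) \<in> homotopy K \<Longrightarrow> (map_path f g p, map_path f g q) \<in> homotopy K"
proof (induction rule: homotopy.induct)
  case (homotopy_refl p)
  then show ?case by (auto simp: paths_def intro!: homotopy.homotopy_refl path_map)
next
  case (homotopy_sym p q)
  then show ?case by (blast intro: homotopy.homotopy_sym)
next
  case (homotopy_trans p q r)
  then show ?case by (blast intro: homotopy.homotopy_trans)
next
  case (homotopy_cancel u as a bs v)
  then have "is_path K (f u) (map (map_prod g id) (as @ [a, reverse_edge a] @ bs)) (f v)"
    by (intro path_map) (simp add: paths_def)
  then show ?case
    using homotopy.homotopy_cancel[of "f u" "map (map_prod g id) as" "map_prod g id a"
        "map (map_prod g id) bs" "f v" K]
    by (simp add: paths_def reverse_edge_map)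
next
  case (homotopy_cell x P Q y u as bs v)
  then show ?case
    using homotopy.homotopy_cell[OF cell_map path_map path_map] by simp
qed

lemma induced_cls:
  assumes "is_path K u es v"
  shows "induced K f g (cls u es v) = cls (f u) (map (map_prod g id) es) (f v)"
proof -
  have "path_class K (map_path f g p) = cls (f u) (map (map_prod g id) es) (f v)"
    if "p \<in> cls u es v" for p
    using equiv_class_eq[OF equiv_homotopy homotopy_map[of "(u, es, v)" p]] that
    by (simp add: path_class_def)
  then show ?thesis
    unfolding induced_def using path_in_cls[OF assms] by (intro SUP_eq_const) auto
qed

lemma induced_edge:
  assumes "e \<in> edges K"
  shows "induced K f g (edge_class K e) = edge_class K (g e)"
  unfolding edge_class_def induced_cls[OF edge_path[OF assms]]
  using assms by (simp add: src_map tgt_map)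

lemma induced_in: "\<alpha> \<in> Arr \<P> \<Longrightarrow> induced K f g \<alpha> \<in> Arr \<P>"
  by (auto elim!: ArrE simp: induced_cls intro!: cls_in path_map)

lemma induced_ends:
  assumes "\<alpha> \<in> Arr \<P>"
  shows "dm \<P> (induced K f g \<alpha>) = f (dm \<P> \<alpha>)" "rg \<P> (induced K f g \<alpha>) = f (rg \<P> \<alpha>)"
  using assms by (auto elim!: ArrE simp: induced_cls dm_cls rg_cls path_map)

lemma induced_cmp:
  assumes "\<alpha> \<in> Arr \<P>" "\<beta> \<in> Arr \<P>" "rg \<P> \<alpha> = dm \<P> \<beta>"
  shows "induced K f g (cmp \<P> \<alpha> \<beta>) = cmp \<P> (induced K f g \<alpha>) (induced K f g \<beta>)"
proof -
  obtain u es v where a: "is_path K u es v" "\<alpha> = cls u es v" using assms(1) by (rule ArrE)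
  obtain v' fs w where b: "is_path K v' fs w" "\<beta> = cls v' fs w" using assms(2) by (rule ArrE)
  have "v' = v" using assms(3) a b by (simp add: dm_cls rg_cls)
  moreover have "is_path K u (es @ fs) w" using a b calculation by (auto simp: is_path_append)
  ultimately show ?thesis using a b by (simp add: induced_cls cmp_cls path_map)
qed

lemma induced_idn: "x \<in> verts K \<Longrightarrow> induced K f g (idn \<P> x) = idn \<P> (f x)"
  by (simp add: idn_eq induced_cls)

end

context wf_two_complex
begin

lemma is_path_edges: "is_path K u es v \<Longrightarrow> fst ` set es \<subseteq> edges K"
  by (induction es arbitrary: u) auto

text \<open>Agreement is asked only on vertices and edges, because monoid laws hold only inside the
  carrier; paths visit nothing else.\<close>

lemma induced_cong:
  assumes "two_complex_endomorphism K f g" "two_complex_endomorphism K f' g'"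
    and "\<And>x. x \<in> verts K \<Longrightarrow> f x = f' x" "\<And>e. e \<in> edges K \<Longrightarrow> g e = g' e" "\<alpha> \<in> Arr \<P>"
  shows "induced K f g \<alpha> = induced K f' g' \<alpha>"
proof -
  obtain u es v where p: "is_path K u es v" "\<alpha> = cls u es v" using assms(5) by (rule ArrE)
  have "map (map_prod g id) es = map (map_prod g' id) es"
    using is_path_edges[OF p(1)] assms(4) by (auto simp: map_prod_def)
  then show ?thesis
    using p is_path_verts[OF p(1)] assms(3)
    by (simp del: map_eq_conv add: two_complex_endomorphism.induced_cls[OF assms(1)]
        two_complex_endomorphism.induced_cls[OF assms(2)])
qed

lemma endomorphism_id: "two_complex_endomorphism K (\<lambda>x. x) (\<lambda>e. e)"
  by unfold_locales (auto simp: map_prod_def)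

lemma induced_id: "\<alpha> \<in> Arr \<P> \<Longrightarrow> induced K (\<lambda>x. x) (\<lambda>e. e) \<alpha> = \<alpha>"
  by (auto elim!: ArrE simp: two_complex_endomorphism.induced_cls[OF endomorphism_id] map_prod_def)

lemma endomorphism_comp:
  assumes "two_complex_endomorphism K f g" "two_complex_endomorphism K f' g'"
  shows "two_complex_endomorphism K (\<lambda>x. f (f' x)) (\<lambda>e. g (g' e))"
proof -
  interpret f: two_complex_endomorphism K f g by fact
  interpret f': two_complex_endomorphism K f' g' by fact
  have "map_prod (\<lambda>e. g (g' e)) (id :: bool \<Rightarrow> bool) = map_prod g id \<circ> map_prod g' id"
    by (auto simp: map_prod_def)
  then show ?thesis
    using f.cell_map[OF f'.cell_map]
    by unfold_locales
      (simp_all add: f.vert_map f'.vert_map f.edge_map f'.edge_map f.src_map f'.src_map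
        f.tgt_map f'.tgt_map)
qed

lemma induced_comp:
  assumes "two_complex_endomorphism K f g" "two_complex_endomorphism K f' g'" "\<alpha> \<in> Arr \<P>"
  shows "induced K f g (induced K f' g' \<alpha>) = induced K (\<lambda>x. f (f' x)) (\<lambda>e. g (g' e)) \<alpha>"
proof -
  obtain u es v where p: "is_path K u es v" "\<alpha> = cls u es v" using assms(3) by (rule ArrE)
  show ?thesis
    using p two_complex_endomorphism.path_map[OF assms(2) p(1)]
    by (simp add: two_complex_endomorphism.induced_cls[OF assms(1)]
        two_complex_endomorphism.induced_cls[OF assms(2)]
        two_complex_endomorphism.induced_cls[OF endomorphism_comp[OF assms(1,2)]]
        map_prod_def split_def o_def)
qed

end

section \<open>The Squier complex\<close>

locale squier_complex =
  fixes X :: "'x set" and R :: "('x word \<times> 'x word) set"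
  assumes relations: "R \<subseteq> words X \<times> words X"
begin

abbreviation "K \<equiv> squier X R"
abbreviation "T \<equiv> vertex_monoid X R"
abbreviation "t w \<equiv> tau X R (rho X w)"
abbreviation "L \<equiv> left_action X R"
abbreviation "A \<equiv> right_action X R"

sublocale T: inverse_monoid T
  by (rule vertex_monoid_is_inverse_monoid[OF relations])

lemma relator_in: "(l, r) \<in> R \<Longrightarrow> t l \<in> carrier T" "(l, r) \<in> R \<Longrightarrow> t r \<in> carrier T"
  using relations by (auto intro: tau_rho_in)

lemma squier_simps:
  "verts K = carrier T"
  "(p, l, r, q) \<in> edges K \<longleftrightarrow> p \<in> carrier T \<and> (l, r) \<in> R \<and> q \<in> carrier T"
  "src K (p, l, r, q) = p \<otimes>\<^bsub>T\<^esub> t l \<otimes>\<^bsub>T\<^esub> q"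
  "tgt K (p, l, r, q) = p \<otimes>\<^bsub>T\<^esub> t r \<otimes>\<^bsub>T\<^esub> q"
  by (auto simp: squier_def Let_def)

text \<open>Unlike in the definition, products are bracketed to the right, as \<open>T.m_assoc\<close> normalises them.\<close>

lemma cellI:
  assumes "p \<in> carrier T" "q \<in> carrier T" "p' \<in> carrier T" "q' \<in> carrier T"
    and "(l, r) \<in> R" "(l', r') \<in> R"
  shows "(p \<otimes>\<^bsub>T\<^esub> (t l \<otimes>\<^bsub>T\<^esub> (q \<otimes>\<^bsub>T\<^esub> (p' \<otimes>\<^bsub>T\<^esub> (t l' \<otimes>\<^bsub>T\<^esub> q')))),
    [((p, l, r, q \<otimes>\<^bsub>T\<^esub> (p' \<otimes>\<^bsub>T\<^esub> (t l' \<otimes>\<^bsub>T\<^esub> q'))), True),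
     ((p \<otimes>\<^bsub>T\<^esub> (t r \<otimes>\<^bsub>T\<^esub> (q \<otimes>\<^bsub>T\<^esub> p')), l', r', q'), True)],
    [((p \<otimes>\<^bsub>T\<^esub> (t l \<otimes>\<^bsub>T\<^esub> (q \<otimes>\<^bsub>T\<^esub> p')), l', r', q'), True),
     ((p, l, r, q \<otimes>\<^bsub>T\<^esub> (p' \<otimes>\<^bsub>T\<^esub> (t r' \<otimes>\<^bsub>T\<^esub> q'))), True)],
    p \<otimes>\<^bsub>T\<^esub> (t r \<otimes>\<^bsub>T\<^esub> (q \<otimes>\<^bsub>T\<^esub> (p' \<otimes>\<^bsub>T\<^esub> (t r' \<otimes>\<^bsub>T\<^esub> q'))))) \<in> cells K"
  unfolding squier_def Let_def two_complex.simps
  by (rule CollectI, rule exI[of _ p], rule exI[of _ l], rule exI[of _ r], rule exI[of _ q],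
      rule exI[of _ p'], rule exI[of _ l'], rule exI[of _ r'], rule exI[of _ q'])
    (use assms in \<open>simp add: relator_in T.m_assoc\<close>)

lemma cellE:
  assumes "c \<in> cells K"
  obtains p l r q p' l' r' q' where "p \<in> carrier T" "q \<in> carrier T" "p' \<in> carrier T" "q' \<in> carrier T"
    "(l, r) \<in> R" "(l', r') \<in> R"
    "c = (p \<otimes>\<^bsub>T\<^esub> (t l \<otimes>\<^bsub>T\<^esub> (q \<otimes>\<^bsub>T\<^esub> (p' \<otimes>\<^bsub>T\<^esub> (t l' \<otimes>\<^bsub>T\<^esub> q')))),
      [((p, l, r, q \<otimes>\<^bsub>T\<^esub> (p' \<otimes>\<^bsub>T\<^esub> (t l' \<otimes>\<^bsub>T\<^esub> q'))), True),
       ((p \<otimes>\<^bsub>T\<^esub> (t r \<otimes>\<^bsub>T\<^esub> (q \<otimes>\<^bsub>T\<^esub> p')), l', r', q'), True)],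
      [((p \<otimes>\<^bsub>T\<^esub> (t l \<otimes>\<^bsub>T\<^esub> (q \<otimes>\<^bsub>T\<^esub> p')), l', r', q'), True),
       ((p, l, r, q \<otimes>\<^bsub>T\<^esub> (p' \<otimes>\<^bsub>T\<^esub> (t r' \<otimes>\<^bsub>T\<^esub> q'))), True)],
      p \<otimes>\<^bsub>T\<^esub> (t r \<otimes>\<^bsub>T\<^esub> (q \<otimes>\<^bsub>T\<^esub> (p' \<otimes>\<^bsub>T\<^esub> (t r' \<otimes>\<^bsub>T\<^esub> q')))))"
proof -
  obtain p l r q p' l' r' q' where c: "p \<in> carrier T" "q \<in> carrier T" "p' \<in> carrier T" "q' \<in> carrier T"
    "(l, r) \<in> R" "(l', r') \<in> R"
    "c = (p \<otimes>\<^bsub>T\<^esub> t l \<otimes>\<^bsub>T\<^esub> q \<otimes>\<^bsub>T\<^esub> p' \<otimes>\<^bsub>T\<^esub> t l' \<otimes>\<^bsub>T\<^esub> q',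
      [((p, l, r, q \<otimes>\<^bsub>T\<^esub> p' \<otimes>\<^bsub>T\<^esub> t l' \<otimes>\<^bsub>T\<^esub> q'), True),
       ((p \<otimes>\<^bsub>T\<^esub> t r \<otimes>\<^bsub>T\<^esub> q \<otimes>\<^bsub>T\<^esub> p', l', r', q'), True)],
      [((p \<otimes>\<^bsub>T\<^esub> t l \<otimes>\<^bsub>T\<^esub> q \<otimes>\<^bsub>T\<^esub> p', l', r', q'), True),
       ((p, l, r, q \<otimes>\<^bsub>T\<^esub> p' \<otimes>\<^bsub>T\<^esub> t r' \<otimes>\<^bsub>T\<^esub> q'), True)],
      p \<otimes>\<^bsub>T\<^esub> t r \<otimes>\<^bsub>T\<^esub> q \<otimes>\<^bsub>T\<^esub> p' \<otimes>\<^bsub>T\<^esub> t r' \<otimes>\<^bsub>T\<^esub> q')"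
    using assms unfolding squier_def Let_def two_complex.simps by blast
  show thesis
    by (rule that[OF c(1-6)]) (use c in \<open>simp add: relator_in T.m_assoc\<close>)
qed

sublocale wf_two_complex K
proof
  fix e assume e: "e \<in> edges K"
  obtain p l r q where "e = (p, l, r, q)" by (cases e)
  then show "src K e \<in> verts K" "tgt K e \<in> verts K"
    using e by (auto simp: squier_simps relator_in)
next
  fix x P Q y assume "(x, P, Q, y) \<in> cells K"
  then show "is_path K x P y \<and> is_path K x Q y"
    by (rule cellE) (simp add: squier_simps relator_in T.m_assoc)
qed

section \<open>Translations of the Squier complex and the two actions\<close>

lemma left_endomorphism:
  assumes s: "s \<in> carrier T"
  shows "two_complex_endomorphism K (\<lambda>x. s \<otimes>\<^bsub>T\<^esub> x) (left_edge X R s)"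
proof
  fix e assume e: "e \<in> edges K"
  obtain p l r q where "e = (p, l, r, q)" by (cases e)
  then show "left_edge X R s e \<in> edges K" "src K (left_edge X R s e) = s \<otimes>\<^bsub>T\<^esub> src K e"
    "tgt K (left_edge X R s e) = s \<otimes>\<^bsub>T\<^esub> tgt K e"
    using e s by (auto simp: squier_simps relator_in left_edge_def T.m_assoc)
next
  fix x P Q y assume "(x, P, Q, y) \<in> cells K"
  then show "(s \<otimes>\<^bsub>T\<^esub> x, map (map_prod (left_edge X R s) id) P,
      map (map_prod (left_edge X R s) id) Q, s \<otimes>\<^bsub>T\<^esub> y) \<in> cells K"
  proof (cases rule: cellE)
    case (1 p l r q p' l' r' q')
    then show ?thesis
      using cellI[OF T.m_closed[OF s 1(1)] 1(2-6)] s
      by (simp add: relator_in left_edge_def T.m_assoc)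
  qed
qed (use s in \<open>simp add: squier_simps\<close>)

lemma right_endomorphism:
  assumes s: "s \<in> carrier T"
  shows "two_complex_endomorphism K (\<lambda>x. x \<otimes>\<^bsub>T\<^esub> s) (\<lambda>e. right_edge X R e s)"
proof
  fix e assume e: "e \<in> edges K"
  obtain p l r q where "e = (p, l, r, q)" by (cases e)
  then show "right_edge X R e s \<in> edges K" "src K (right_edge X R e s) = src K e \<otimes>\<^bsub>T\<^esub> s"
    "tgt K (right_edge X R e s) = tgt K e \<otimes>\<^bsub>T\<^esub> s"
    using e s by (auto simp: squier_simps relator_in right_edge_def T.m_assoc)
next
  fix x P Q y assume "(x, P, Q, y) \<in> cells K"
  then show "(x \<otimes>\<^bsub>T\<^esub> s, map (map_prod (\<lambda>e. right_edge X R e s) id) P,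
      map (map_prod (\<lambda>e. right_edge X R e s) id) Q, y \<otimes>\<^bsub>T\<^esub> s) \<in> cells K"
  proof (cases rule: cellE)
    case (1 p l r q p' l' r' q')
    then show ?thesis
      using cellI[OF 1(1-3) T.m_closed[OF 1(4) s] 1(5,6)] s
      by (simp add: relator_in right_edge_def T.m_assoc)
  qed
qed (use s in \<open>simp add: squier_simps\<close>)

lemma action_edge:
  assumes "(p, l, r, q) \<in> edges K" "s \<in> carrier T"
  shows "L s (edge_class K (p, l, r, q)) = edge_class K (s \<otimes>\<^bsub>T\<^esub> p, l, r, q)"
    and "A (edge_class K (p, l, r, q)) s = edge_class K (p, l, r, q \<otimes>\<^bsub>T\<^esub> s)"
  using two_complex_endomorphism.induced_edge[OF left_endomorphism[OF assms(2)] assms(1)]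
    two_complex_endomorphism.induced_edge[OF right_endomorphism[OF assms(2)] assms(1)]
  by (simp_all add: left_action_def right_action_def left_edge_def right_edge_def)

lemma semiregular: "semiregular_groupoid \<P> T L A"
proof (intro semiregular_groupoid.intro semiregular_groupoid_axioms.intro)
  show "groupoid \<P>" "monoid T" by unfold_locales
  show V: "carrier T = Vert \<P>" by (simp add: Vert_eq squier_simps)
  fix x y \<alpha> assume "x \<in> Vert \<P>" "y \<in> Vert \<P>"
  then have x: "x \<in> carrier T" and y: "y \<in> carrier T" by (simp_all add: V)
  note lx = left_endomorphism[OF x] and ly = left_endomorphism[OF y]
    and rx = right_endomorphism[OF x] and ry = right_endomorphism[OF y]
  show "L x (idn \<P> y) = idn \<P> (x \<otimes>\<^bsub>T\<^esub> y)" "A (idn \<P> x) y = idn \<P> (x \<otimes>\<^bsub>T\<^esub> y)"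
    using two_complex_endomorphism.induced_idn[OF lx] two_complex_endomorphism.induced_idn[OF ry] x y
    by (simp_all add: left_action_def right_action_def squier_simps)
  assume a: "\<alpha> \<in> Arr \<P>"
  show "L (x \<otimes>\<^bsub>T\<^esub> y) \<alpha> = L x (L y \<alpha>)"
    unfolding left_action_def induced_comp[OF lx ly a]
    by (rule induced_cong[OF left_endomorphism endomorphism_comp[OF lx ly] _ _ a])
      (use x y in \<open>auto simp: squier_simps left_edge_def T.m_assoc\<close>)
  \<comment> \<open>For the right action the translation by \<open>y\<close> is applied last, so it
    is the outer map of the composite.\<close>
  show "A \<alpha> (x \<otimes>\<^bsub>T\<^esub> y) = A (A \<alpha> x) y"
    unfolding right_action_def induced_comp[OF ry rx a]
    by (rule induced_cong[OF right_endomorphism endomorphism_comp[OF ry rx] _ _ a])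
      (use x y in \<open>auto simp: squier_simps right_edge_def T.m_assoc\<close>)
  show "A (L x \<alpha>) y = L x (A \<alpha> y)"
    unfolding left_action_def right_action_def induced_comp[OF ry lx a] induced_comp[OF lx ry a]
    by (rule induced_cong[OF endomorphism_comp[OF ry lx] endomorphism_comp[OF lx ry] _ _ a])
      (use x y in \<open>auto simp: squier_simps left_edge_def right_edge_def T.m_assoc\<close>)
next
  fix \<alpha> assume a: "\<alpha> \<in> Arr \<P>"
  have "L \<one>\<^bsub>T\<^esub> \<alpha> = induced K (\<lambda>x. x) (\<lambda>e. e) \<alpha>"
    unfolding left_action_def
    by (rule induced_cong[OF left_endomorphism endomorphism_id _ _ a])
      (auto simp: squier_simps left_edge_def)
  then show "L \<one>\<^bsub>T\<^esub> \<alpha> = \<alpha>" by (simp add: induced_id[OF a])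
  have "A \<alpha> \<one>\<^bsub>T\<^esub> = induced K (\<lambda>x. x) (\<lambda>e. e) \<alpha>"
    unfolding right_action_def
    by (rule induced_cong[OF right_endomorphism endomorphism_id _ _ a])
      (auto simp: squier_simps right_edge_def)
  then show "A \<alpha> \<one>\<^bsub>T\<^esub> = \<alpha>" by (simp add: induced_id[OF a])
next
  fix x \<alpha> assume "x \<in> Vert \<P>" and a: "\<alpha> \<in> Arr \<P>"
  then have x: "x \<in> carrier T" by (simp add: Vert_eq squier_simps)
  interpret l: two_complex_endomorphism K "\<lambda>y. x \<otimes>\<^bsub>T\<^esub> y" "left_edge X R x"
    by (rule left_endomorphism[OF x])
  interpret r: two_complex_endomorphism K "\<lambda>y. y \<otimes>\<^bsub>T\<^esub> x" "\<lambda>e. right_edge X R e x"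
    by (rule right_endomorphism[OF x])
  show "L x \<alpha> \<in> Arr \<P>" "A \<alpha> x \<in> Arr \<P>"
    "dm \<P> (L x \<alpha>) = x \<otimes>\<^bsub>T\<^esub> dm \<P> \<alpha>" "dm \<P> (A \<alpha> x) = dm \<P> \<alpha> \<otimes>\<^bsub>T\<^esub> x"
    "rg \<P> (L x \<alpha>) = x \<otimes>\<^bsub>T\<^esub> rg \<P> \<alpha>" "rg \<P> (A \<alpha> x) = rg \<P> \<alpha> \<otimes>\<^bsub>T\<^esub> x"
    using a by (simp_all add: left_action_def right_action_def l.induced_in r.induced_in
        l.induced_ends r.induced_ends)
  fix \<beta> assume "\<beta> \<in> Arr \<P>" "rg \<P> \<alpha> = dm \<P> \<beta>"
  then show "L x (cmp \<P> \<alpha> \<beta>) = cmp \<P> (L x \<alpha>) (L x \<beta>)"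
    "A (cmp \<P> \<alpha> \<beta>) x = cmp \<P> (A \<alpha> x) (A \<beta> x)"
    using a by (simp_all add: left_action_def right_action_def l.induced_cmp r.induced_cmp)
qed

sublocale semiregular_groupoid \<P> T L A
  by (rule semiregular)

section \<open>Interchange for edges and then for all arrows\<close>

lemma cmp_edges:
  assumes "e \<in> edges K" "e' \<in> edges K" "tgt K e = src K e'"
  shows "cmp \<P> (edge_class K e) (edge_class K e') = cls (src K e) [(e, True), (e', True)] (tgt K e')"
  using cmp_cls[OF edge_path[OF assms(1)], of "[(e', True)]" "tgt K e'"] edge_path[OF assms(2)]
  by (simp add: edge_class_def assms(3))

text \<open>The four translated edges given by \<open>action_edge\<close> form the boundary of the
  cell with the same eight parameters, once products are bracketed to the right.\<close>

lemma interchanges_edges: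
  assumes "e \<in> edges K" "e' \<in> edges K"
  shows "interchanges (edge_class K e) (edge_class K e')"
proof -
  obtain p l r q where e: "e = (p, l, r, q)" by (cases e)
  obtain p' l' r' q' where e': "e' = (p', l', r', q')" by (cases e')
  have c: "p \<in> carrier T" "q \<in> carrier T" "p' \<in> carrier T" "q' \<in> carrier T"
    "(l, r) \<in> R" "(l', r') \<in> R"
    using assms by (auto simp: e e' squier_simps)
  have ends: "dm \<P> (edge_class K d) = src K d" "rg \<P> (edge_class K d) = tgt K d"
    if "d \<in> edges K" for d
    using edge_path[OF that] by (simp_all add: edge_class_def dm_cls rg_cls del: is_path.simps)
  show ?thesis
    using cls_cell[OF cellI[OF c]] c assms unfolding interchanges_def e e'
    by (simp add: ends action_edge cmp_edges squier_simps relator_in T.m_assoc)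
qed

text \<open>Two inductions in succession: the first lets \<open>\<alpha>\<close> grow from edges
  against a fixed edge, the second lets \<open>\<beta>\<close> grow against the fixed arrow
  \<open>\<alpha>\<close>, with the first as its edge case.\<close>

lemma interchanges_arrows:
  assumes "\<alpha> \<in> Arr \<P>" "\<beta> \<in> Arr \<P>"
  shows "interchanges \<alpha> \<beta>"
proof -
  have edge_in: "edge_class K e \<in> Arr \<P>" if "e \<in> edges K" for e
    using cls_in[OF edge_path[OF that]] by (simp add: edge_class_def)
  have 1: "interchanges \<alpha> (edge_class K e)" if e: "e \<in> edges K" for e
    using assms(1)
  proof (induction \<alpha> rule: Arr_induct)
    case (idn x)
    then show ?case using e by (simp add: interchanges_idn_left edge_in Vert_eq)
  next
    case (edge e')
    then show ?case using e by (rule interchanges_edges)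
  next
    case (inverse \<beta> \<gamma>)
    then show ?case using e by (blast intro: interchanges_inverse_left edge_in)
  next
    case (cmp \<beta> \<gamma>)
    then show ?case using e by (simp add: interchanges_cmp_left edge_in)
  qed
  show ?thesis
    using assms(2)
  proof (induction \<beta> rule: Arr_induct)
    case (idn x)
    then show ?case using assms(1) by (simp add: interchanges_idn_right Vert_eq)
  next
    case (edge e)
    then show ?case by (rule 1)
  next
    case (inverse \<beta> \<gamma>)
    then show ?case using assms(1) by (blast intro: interchanges_inverse_right)
  next
    case (cmp \<beta> \<gamma>)
    then show ?case using assms(1) by (simp add: interchanges_cmp_right)
  qed
qed

end

theorem proposition4p1:
  fixes X :: "'x set" and R :: "('x word \<times> 'x word) set"
  assumes "R \<subseteq> words X \<times> words X"
  shows "pseudoregular_groupoid (fundamental_groupoid (squier X R)) (vertex_monoid X R)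
           (left_action X R) (right_action X R) \<and>
         monoidal_groupoid (fundamental_groupoid (squier X R)) (vertex_monoid X R)
           (left_action X R) (right_action X R) \<and>
         (\<forall>t \<in> carrier (vertex_monoid X R). \<forall>p l r q. (p, l, r, q) \<in> edges (squier X R) \<longrightarrow>
           left_action X R t (edge_class (squier X R) (p, l, r, q)) =
             edge_class (squier X R) (t \<otimes>\<^bsub>vertex_monoid X R\<^esub> p, l, r, q) \<and>
           right_action X R (edge_class (squier X R) (p, l, r, q)) t =
             edge_class (squier X R) (p, l, r, q \<otimes>\<^bsub>vertex_monoid X R\<^esub> t))"
proof -
  interpret squier_complex X R by unfold_locales (rule assms)
  have "pseudoregular_groupoid \<P> T L A"
    by (intro pseudoregular_groupoid.intro semiregular_groupoid_axioms T.inverse_monoid_axioms)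
  moreover have "monoidal_groupoid \<P> T L A"
    by unfold_locales (use interchanges_arrows in \<open>simp add: interchanges_def\<close>)
  ultimately show ?thesis using action_edge by blast
qed

end
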